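(* Let the data $(\lambda,\kappa;S_i,W_i,N_i,E_i,\tau^J_i)$ (all entries nonzero) satisfy all the $D^{(1)}_n$ bilinear equations $\langle J,i\rangle$ ($1\le J\le 4$, $0\le i\le n$), and put $x=[\lambda;\tau^3,W,\tau^2]$, $y=[\kappa;\tau^2,N,\tau^1]$, $x'=[\kappa;\tau^3,S,\tau^4]$, $y'=[\lambda;\tau^4,E,\tau^1]$ in $\mathcal B_n$. (i) ($A^{(2)}_{2n-3}$) If $\lambda_n=\kappa_n=1$ and $\tau^J_{n-1}=\tau^J_n$ for $0\le J\le4$, then $\langle J,n-1\rangle$ and $\langle J,n\rangle$ are equivalent for each $J$, one has $x_n=y_n=x'_n=y'_n=1$, and the elements of $\mathcal B'$ mapped by $\rho$ to $x,y,x',y'$ are related by the $A^{(2)}_{2n-3}$ tropical $R$: $R'_{n-1}(\rho^{-1}(x),\rho^{-1}(y))=(\rho^{-1}(x'),\rho^{-1}(y'))$. (ii) ($C^{(1)}_{n-2}$) If moreover $\lambda_1=\bar\lambda_1$, $\kappa_1=\bar\kappa_1$ and $\tau^J_0=\tau^J_1$ for $0\le J\le 4$, then $\langle J,0\rangle$ and $\langle J,1\rangle$ are also equivalent for each $J$, one has $x_1=\bar x_1$, $y_1=\bar y_1$, $x'_1=\bar x'_1$, $y'_1=\bar y'_1$, and the elements of $\mathcal B''$ mapped by $\rho'$ to $x,y,x',y'$ are related by the $C^{(1)}_{n-2}$ tropical $R$: $R''_{n-2}(\rho'^{-1}(x),\rho'^{-1}(y))=(\rho'^{-1}(x'),\r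ho'^{-1}(y'))$.
   Context: Fix an integer $n\ge 3$; all quantities are complex numbers. $\mathcal B=\mathcal B_n$ is the set of tuples $x=(x_1,\dots,x_n,\bar x_{n-1},\dots,\bar x_1)$ of nonzero numbers, and $\ell(x)=x_1\cdots x_n\bar x_{n-1}\cdots\bar x_1$. Fix $\lambda,\kappa\in\mathcal B$, $l=\ell(\lambda)$, $k=\ell(\kappa)$, with $lk(l-k)\neq0$; $\alpha,\beta$ are nonzero parameters. Tau functions: $S_i,W_i,N_i,E_i$ ($1\le i\le n-2$), $\tau^J_i$ ($0\le J\le 4$, $0\le i\le n$). The $D^{(1)}_n$ bilinear equations $\langle J,i\rangle$ are: $\langle1,0\rangle$: $\bar\kappa_1N_1\tau^4_1-\bar\lambda_1E_1\tau^2_1=\alpha\tau^0_0\tau^1_0$; $\langle1,1\rangle$: $\kappa_1N_1\tau^4_0-\lambda_1E_1\tau^2_0=\alpha\tau^0_1\tau^1_1$; $\langle1,i\rangle$ ($2\le i\le n-2$): $\kappa_iE_{i-1}N_i-\lambda_iN_{i-1}E_i=\alpha\tau^0_i\tau^1_i$; $\langle1,n-1\rangle$: $\kappa_{n-1}\kappa_nE_{n-2}\tau^2_n-\lambda_{n-1}\lambda_nN_{n-2}\tau^4_n=\alpha\tau^0_{n-1}\tau^1_n$; $\langle1,n\rangle$: $\kappa_{n-1}E_{n-2}\tau^2_{n-1}-\lambda_{n-1}N_{n-2}\tau^4_{n-1}=\alpha\tau^0_n\tau^1_{n-1}$; $\langle2,0\rangle$: $\kappa_1N_1\tau^3_1+\bar\lambda_1W_1\tau^1_1=\beta\tau^0_0\tau^2_0$;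 $\langle2,1\rangle$: $\bar\kappa_1N_1\tau^3_0+\lambda_1W_1\tau^1_0=\beta\tau^0_1\tau^2_1$; $\langle2,i\rangle$ ($2\le i\le n-2$): $\bar\kappa_iW_{i-1}N_i+\lambda_iN_{i-1}W_i=\beta\tau^0_i\tau^2_i$; $\langle2,n-1\rangle$: $\kappa_n\bar\kappa_{n-1}W_{n-2}\tau^1_{n-1}+\lambda_{n-1}N_{n-2}\tau^3_{n-1}=\beta\tau^0_{n-1}\tau^2_{n-1}$; $\langle2,n\rangle$: $\bar\kappa_{n-1}W_{n-2}\tau^1_n+\lambda_{n-1}\lambda_nN_{n-2}\tau^3_n=\beta\tau^0_n\tau^2_n$; $\langle3,0\rangle$: $\kappa_1S_1\tau^2_1-\lambda_1W_1\tau^4_1=\alpha\tau^0_0\tau^3_0$; $\langle3,1\rangle$: $\bar\kappa_1S_1\tau^2_0-\bar\lambda_1W_1\tau^4_0=\alpha\tau^0_1\tau^3_1$; $\langle3,i\rangle$ ($2\le i\le n-2$): $\bar\kappa_iW_{i-1}S_i-\bar\lambda_iS_{i-1}W_i=\alpha\tau^0_i\tau^3_i$; $\langle3,n-1\rangle$: $\bar\kappa_{n-1}W_{n-2}\tau^4_n-\bar\lambda_{n-1}S_{n-2}\tau^2_n=\alpha\tau^0_{n-1}\tau^3_n$; $\langle3,n\rangle$: $\kappa_n\bar\kappa_{n-1}W_{n-2}\tau^4_{n-1}-\lambda_n\bar\lambda_{n-1}S_{n-2}\tau^2_{n-1}=\alpha\tau^0_n\tau^3_{n-1}$; $\langle4,0\rangle$: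 $\bar\kappa_1S_1\tau^1_1+\lambda_1E_1\tau^3_1=\beta\tau^0_0\tau^4_0$; $\langle4,1\rangle$: $\kappa_1S_1\tau^1_0+\bar\lambda_1E_1\tau^3_0=\beta\tau^0_1\tau^4_1$; $\langle4,i\rangle$ ($2\le i\le n-2$): $\kappa_iE_{i-1}S_i+\bar\lambda_iS_{i-1}E_i=\beta\tau^0_i\tau^4_i$; $\langle4,n-1\rangle$: $\kappa_{n-1}E_{n-2}\tau^3_{n-1}+\lambda_n\bar\lambda_{n-1}S_{n-2}\tau^1_{n-1}=\beta\tau^0_{n-1}\tau^4_{n-1}$; $\langle4,n\rangle$: $\kappa_{n-1}\kappa_nE_{n-2}\tau^3_n+\bar\lambda_{n-1}S_{n-2}\tau^1_n=\beta\tau^0_n\tau^4_n$. Parameterization. For $\mu\in\mathcal B$, $C=(C_1,\dots,C_{n-2})$, $\tau=(\tau_0,\dots,\tau_n)$, $\tau'=(\tau'_0,\dots,\tau'_n)$, the element $[\mu;\tau,C,\tau']=(z_1,\dots,z_n,\bar z_{n-1},\dots,\bar z_1)\in\mathcal B$ is, for $n\ge4$: $z_1=\mu_1^{-1}\frac{\tau_0\tau'_1}{C_1}$, $\bar z_1=\bar\mu_1^{-1}\frac{\tau_1\tau'_0}{C_1}$, $z_2=\mu_2^{-1}\frac{C_1\tau'_2}{C_2\tau'_0\tau'_1}$, $\bar z_2=\bar\mu_2^{-1}\frac{C_1\tau_2}{C_2\tau_0\tau_1}$, and $z_i=\mu_i^{-1}\frac{C_{i-1}\tau'_i}{C_i\tau'_{i-1}}$,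 $\bar z_i=\bar\mu_i^{-1}\frac{C_{i-1}\tau_i}{C_i\tau_{i-1}}$ ($3\le i\le n-2$), $z_{n-1}=\mu_{n-1}^{-1}\frac{C_{n-2}\tau'_{n-1}}{\tau_{n-1}\tau'_{n-2}}$, $\bar z_{n-1}=\bar\mu_{n-1}^{-1}\frac{C_{n-2}\tau_n}{\tau_{n-2}\tau'_n}$, $z_n=\mu_n^{-1}\frac{\tau_{n-1}\tau'_n}{\tau_n\tau'_{n-1}}$. For $n=3$: $z_1=\mu_1^{-1}\frac{\tau_0\tau'_1}{C_1}$, $\bar z_1=\bar\mu_1^{-1}\frac{\tau_1\tau'_0}{C_1}$, $z_2=\mu_2^{-1}\frac{C_1\tau'_2}{\tau_2\tau'_0\tau'_1}$, $\bar z_2=\bar\mu_2^{-1}\frac{C_1\tau_3}{\tau_0\tau_1\tau'_3}$, $z_3=\mu_3^{-1}\frac{\tau_2\tau'_3}{\tau_3\tau'_2}$. Here $\tau^J=(\tau^J_0,\dots,\tau^J_n)$, $W=(W_1,\dots,W_{n-2})$, etc. Tropical $R$ for $D^{(1)}_n$, denoted $R_n$. Involutions: $\sigma_1$ on $\mathcal B$ exchanges $x_1\leftrightarrow\bar x_1$; $\sigma_n$ sends $x_{n-1}\mapsto x_{n-1}x_n$, $\bar x_{n-1}\mapsto\bar x_{n-1}x_n$, $x_n\mapsto1/x_n$; both fix the other entries and act diagonally on $\mathcal B\times\mathcal B$; $\sigma_\ast$ on $\mathcal B\times\mathcal B$ exchanges $x_i\leftrightarrow\bar y_i$, $\bar x_i\leftrightarrow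 y_i$ ($1\le i\le n-1$), $x_n\leftrightarrow y_n$. $F^{\sigma_a}(x,y)=F(\sigma_a(x,y))$. Set $$V_0=\ell(x)\tfrac{y_1}{\bar y_1}+\ell(x)\sum_{m=2}^{n-1}\Bigl(\prod_{i=1}^{m-1}\tfrac{y_i}{x_i}\Bigr)\Bigl(1+\tfrac{y_m}{\bar y_m}\Bigr)+x_ny_n\prod_{i=1}^{n-1}\bar x_iy_i+\ell(y)\tfrac{\bar x_1}{x_1}+\ell(y)\sum_{m=2}^{n-1}\Bigl(\prod_{i=1}^{m-1}\tfrac{\bar x_i}{\bar y_i}\Bigr)\Bigl(1+\tfrac{\bar x_m}{x_m}\Bigr)+\prod_{i=1}^{n-1}\bar x_iy_i,$$ $V_i=\bar y_i\bigl(\frac1{\bar x_i}V_{i-1}+(\ell(x)-\ell(y))(\frac1{x_i}+\frac1{\bar y_i})\bigr)$ for $1\le i\le n-2$, $V_{n-1}=\frac{\bar y_{n-1}}{y_n}\bigl(\frac{y_n}{\bar x_{n-1}}V_{n-2}+(\ell(x)-\ell(y))(\frac{y_n}{x_{n-1}}+\frac1{\bar y_{n-1}})\bigr)$; $U_1=V_0V_0^{\sigma_1}$, $U_{n-1}=V_{n-1}V_{n-1}^{\sigma_\ast}$, $U_i=(\frac1{x_i}+\frac1{\bar y_i})^{-1}\bigl(\frac1{y_i}V_iV_{i-1}^{\sigma_\ast}+\frac1{\bar x_i}V_{i-1}V_i^{\sigma_\ast}\bigr)$ for $2\le i\le n-2$. $R_n(x,y)=(x',y')$ is given by $x_1'=y_1\frac{V_0^{\sigma_1}}{V_1}$,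 $\bar x_1'=\bar y_1\frac{V_0}{V_1}$, $x_i'=y_i\frac{V_{i-1}U_i}{V_iU_{i-1}}$, $\bar x'_i=\bar y_i\frac{V_{i-1}}{V_i}$ ($2\le i\le n-1$), $x'_n=y_n\frac{V_{n-1}}{V_{n-1}^{\sigma_n}}$, $y_1'=x_1\frac{V_0}{V_1^{\sigma_\ast}}$, $\bar y'_1=\bar x_1\frac{V_0^{\sigma_1}}{V_1^{\sigma_\ast}}$, $y'_i=x_i\frac{V_{i-1}^{\sigma_\ast}}{V_i^{\sigma_\ast}}$, $\bar y'_i=\bar x_i\frac{V_{i-1}^{\sigma_\ast}U_i}{V_i^{\sigma_\ast}U_{i-1}}$ ($2\le i\le n-1$), $y'_n=x_n\frac{V_{n-1}^{\sigma_n}}{V_{n-1}}$. Reductions. For $m\ge1$: $\mathcal B'=\{(x_1,\dots,x_m,\bar x_m,\dots,\bar x_1)\}$, $\rho:\mathcal B'\to\mathcal B_{m+1}$, $\rho(x_1,\dots,x_m,\bar x_m,\dots,\bar x_1)=(x_1,\dots,x_m,1,\bar x_m,\dots,\bar x_1)$; the tropical $R$ for $A^{(2)}_{2m-1}$ is the map $R'_m$ on $\mathcal B'\times\mathcal B'$ with $R'_m(x,y)=(x',y')\Leftrightarrow R_{m+1}(\rho(x),\rho(y))=(\rho(x'),\rho(y'))$. $\mathcal B''=\{(x_0,x_1,\dots,x_m,\bar x_m,\dots,\bar x_1)\}$, $\rho':\mathcal B''\to\mathcal B_{m+2}$, $\rho'(x_0,x_1,\dots,x_m,\bar x_m,\dots,\bar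 x_1)=(x_0,x_1,\dots,x_m,1,\bar x_m,\dots,\bar x_1,x_0)$; the tropical $R$ for $C^{(1)}_m$ is $R''_m$ on $\mathcal B''\times\mathcal B''$ with $R''_m(x,y)=(x',y')\Leftrightarrow R_{m+2}(\rho'(x),\rho'(y))=(\rho'(x'),\rho'(y'))$. (In (i) $m=n-1$, in (ii) $m=n-2$.) *)

theory Defs
  imports Complex_Main "HOL-Library.FuncSet"
begin

text \<open>
  A tuple $(x_1,\dots,x_n,\bar x_{n-1},\dots,\bar x_1)$ is a pair of functions on the indices:
  the first component holds the unbarred entries, the second one the barred entries.  Both
  are \<^const>\<open>undefined\<close> off their index range, so that equality of tuples is equality of entries.
\<close>

type_synonym tuple = "(nat \<Rightarrow> complex) \<times> (nat \<Rightarrow> complex)"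

definition tuples :: "nat \<Rightarrow> tuple set" where
  "tuples n = ({1..n} \<rightarrow>\<^sub>E - {0}) \<times> ({1..n-1} \<rightarrow>\<^sub>E - {0})"

definition ell :: "nat \<Rightarrow> tuple \<Rightarrow> complex" where
  "ell n = (\<lambda>(x, xb). (\<Prod>i=1..n. x i) * (\<Prod>i=1..n-1. xb i))"


section \<open>The bilinear equations\<close>

text \<open>
  The unbarred and barred entries of $\lambda$ and $\kappa$ are \<open>l\<close>, \<open>lb\<close>, \<open>k\<close>, \<open>kb\<close>, and
  \<open>t J i\<close> is $\tau^J_i$.  For $n\ge 3$ the cases $i=0$, $i=1$, $i=n-1$, $i=n$,
  $2\le i\le n-2$ are mutually exclusive; the last branch is used only for $2\le i\le n-2$.
\<close>

definition bilinear1 :: "nat \<Rightarrow> complex \<Rightarrow> tuple \<Rightarrow> tuple \<Rightarrow> (nat \<Rightarrow> complex) \<Rightarrow> (nat \<Rightarrow> complex)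
    \<Rightarrow> (nat \<Rightarrow> nat \<Rightarrow> complex) \<Rightarrow> nat \<Rightarrow> bool" where
  "bilinear1 n \<alpha> = (\<lambda>(l, lb) (k, kb) N E t i.
     if i = 0 then
       kb 1 * N 1 * t 4 1 - lb 1 * E 1 * t 2 1 = \<alpha> * t 0 0 * t 1 0
     else if i = 1 then
       k 1 * N 1 * t 4 0 - l 1 * E 1 * t 2 0 = \<alpha> * t 0 1 * t 1 1
     else if i = n - 1 then
       k (n-1) * k n * E (n-2) * t 2 n - l (n-1) * l n * N (n-2) * t 4 n
         = \<alpha> * t 0 (n-1) * t 1 n
     else if i = n then
       k (n-1) * E (n-2) * t 2 (n-1) - l (n-1) * N (n-2) * t 4 (n-1)
         = \<alpha> * t 0 n * t 1 (n-1)
     else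
       k i * E (i-1) * N i - l i * N (i-1) * E i = \<alpha> * t 0 i * t 1 i)"

definition bilinear2 :: "nat \<Rightarrow> complex \<Rightarrow> tuple \<Rightarrow> tuple \<Rightarrow> (nat \<Rightarrow> complex) \<Rightarrow> (nat \<Rightarrow> complex)
    \<Rightarrow> (nat \<Rightarrow> nat \<Rightarrow> complex) \<Rightarrow> nat \<Rightarrow> bool" where
  "bilinear2 n \<beta> = (\<lambda>(l, lb) (k, kb) W N t i.
     if i = 0 then
       k 1 * N 1 * t 3 1 + lb 1 * W 1 * t 1 1 = \<beta> * t 0 0 * t 2 0
     else if i = 1 then
       kb 1 * N 1 * t 3 0 + l 1 * W 1 * t 1 0 = \<beta> * t 0 1 * t 2 1
     else if i = n - 1 then
       k n * kb (n-1) * W (n-2) * t 1 (n-1) + l (n-1) * N (n-2) * t 3 (n-1)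
         = \<beta> * t 0 (n-1) * t 2 (n-1)
     else if i = n then
       kb (n-1) * W (n-2) * t 1 n + l (n-1) * l n * N (n-2) * t 3 n
         = \<beta> * t 0 n * t 2 n
     else
       kb i * W (i-1) * N i + l i * N (i-1) * W i = \<beta> * t 0 i * t 2 i)"

definition bilinear3 :: "nat \<Rightarrow> complex \<Rightarrow> tuple \<Rightarrow> tuple \<Rightarrow> (nat \<Rightarrow> complex) \<Rightarrow> (nat \<Rightarrow> complex)
    \<Rightarrow> (nat \<Rightarrow> nat \<Rightarrow> complex) \<Rightarrow> nat \<Rightarrow> bool" where
  "bilinear3 n \<alpha> = (\<lambda>(l, lb) (k, kb) S W t i.
     if i = 0 then
       k 1 * S 1 * t 2 1 - l 1 * W 1 * t 4 1 = \<alpha> * t 0 0 * t 3 0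
     else if i = 1 then
       kb 1 * S 1 * t 2 0 - lb 1 * W 1 * t 4 0 = \<alpha> * t 0 1 * t 3 1
     else if i = n - 1 then
       kb (n-1) * W (n-2) * t 4 n - lb (n-1) * S (n-2) * t 2 n
         = \<alpha> * t 0 (n-1) * t 3 n
     else if i = n then
       k n * kb (n-1) * W (n-2) * t 4 (n-1) - l n * lb (n-1) * S (n-2) * t 2 (n-1)
         = \<alpha> * t 0 n * t 3 (n-1)
     else
       kb i * W (i-1) * S i - lb i * S (i-1) * W i = \<alpha> * t 0 i * t 3 i)"

definition bilinear4 :: "nat \<Rightarrow> complex \<Rightarrow> tuple \<Rightarrow> tuple \<Rightarrow> (nat \<Rightarrow> complex) \<Rightarrow> (nat \<Rightarrow> complex)
    \<Rightarrow> (nat \<Rightarrow> nat \<Rightarrow> complex) \<Rightarrow> nat \<Rightarrow> bool" where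
  "bilinear4 n \<beta> = (\<lambda>(l, lb) (k, kb) S E t i.
     if i = 0 then
       kb 1 * S 1 * t 1 1 + l 1 * E 1 * t 3 1 = \<beta> * t 0 0 * t 4 0
     else if i = 1 then
       k 1 * S 1 * t 1 0 + lb 1 * E 1 * t 3 0 = \<beta> * t 0 1 * t 4 1
     else if i = n - 1 then
       k (n-1) * E (n-2) * t 3 (n-1) + l n * lb (n-1) * S (n-2) * t 1 (n-1)
         = \<beta> * t 0 (n-1) * t 4 (n-1)
     else if i = n then
       k (n-1) * k n * E (n-2) * t 3 n + lb (n-1) * S (n-2) * t 1 n
         = \<beta> * t 0 n * t 4 n
     else
       k i * E (i-1) * S i + lb i * S (i-1) * E i = \<beta> * t 0 i * t 4 i)"

text \<open>The equation $\langle J,i\rangle$, for $1\le J\le 4$.\<close>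

definition bilinear :: "nat \<Rightarrow> complex \<Rightarrow> complex \<Rightarrow> tuple \<Rightarrow> tuple
    \<Rightarrow> (nat \<Rightarrow> complex) \<Rightarrow> (nat \<Rightarrow> complex) \<Rightarrow> (nat \<Rightarrow> complex) \<Rightarrow> (nat \<Rightarrow> complex)
    \<Rightarrow> (nat \<Rightarrow> nat \<Rightarrow> complex) \<Rightarrow> nat \<Rightarrow> nat \<Rightarrow> bool" where
  "bilinear n \<alpha> \<beta> lam kap S W N E t J i =
     (if J = 1 then bilinear1 n \<alpha> lam kap N E t i
      else if J = 2 then bilinear2 n \<beta> lam kap W N t i
      else if J = 3 then bilinear3 n \<alpha> lam kap S W t i
      else bilinear4 n \<beta> lam kap S E t i)"


section \<open>The parameterization $[\mu;\tau,C,\tau']$\<close>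

definition param :: "nat \<Rightarrow> tuple \<Rightarrow> (nat \<Rightarrow> complex) \<Rightarrow> (nat \<Rightarrow> complex) \<Rightarrow> (nat \<Rightarrow> complex)
    \<Rightarrow> tuple" where
  "param n = (\<lambda>(m, mb) t C t'.
     if n = 3 then
       (\<lambda>i\<in>{1..3}. inverse (m i) *
          (if i = 1 then t 0 * t' 1 / C 1
           else if i = 2 then C 1 * t' 2 / (t 2 * t' 0 * t' 1)
           else t 2 * t' 3 / (t 3 * t' 2)),
        \<lambda>i\<in>{1..2}. inverse (mb i) *
          (if i = 1 then t 1 * t' 0 / C 1
           else C 1 * t 3 / (t 0 * t 1 * t' 3)))
     else
       (\<lambda>i\<in>{1..n}. inverse (m i) *
          (if i = 1 then t 0 * t' 1 / C 1
           else if i = 2 then C 1 * t' 2 / (C 2 * t' 0 * t' 1)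
           else if i = n - 1 then C (n-2) * t' (n-1) / (t (n-1) * t' (n-2))
           else if i = n then t (n-1) * t' n / (t n * t' (n-1))
           else C (i-1) * t' i / (C i * t' (i-1))),
        \<lambda>i\<in>{1..n-1}. inverse (mb i) *
          (if i = 1 then t 1 * t' 0 / C 1
           else if i = 2 then C 1 * t 2 / (C 2 * t 0 * t 1)
           else if i = n - 1 then C (n-2) * t n / (t (n-2) * t' n)
           else C (i-1) * t i / (C i * t (i-1)))))"


section \<open>The tropical $R$ for $D^{(1)}_n$\<close>

definition sigma_1 :: "tuple \<times> tuple \<Rightarrow> tuple \<times> tuple" where
  "sigma_1 = (let s = (\<lambda>(x, xb). (x(1 := xb 1), xb(1 := x 1))) in map_prod s s)"

definition sigma_n :: "nat \<Rightarrow> tuple \<times> tuple \<Rightarrow> tuple \<times> tuple" where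
  "sigma_n n =
     (let s = (\<lambda>(x, xb). (x(n-1 := x (n-1) * x n, n := 1 / x n), xb(n-1 := xb (n-1) * x n)))
      in map_prod s s)"

definition sigma_star :: "nat \<Rightarrow> tuple \<times> tuple \<Rightarrow> tuple \<times> tuple" where
  "sigma_star n = (\<lambda>((x, xb), (y, yb)).
     ((\<lambda>i\<in>{1..n}. if i = n then y n else yb i, \<lambda>i\<in>{1..n-1}. y i),
      (\<lambda>i\<in>{1..n}. if i = n then x n else xb i, \<lambda>i\<in>{1..n-1}. x i)))"

definition V0 :: "nat \<Rightarrow> tuple \<times> tuple \<Rightarrow> complex" where
  "V0 n = (\<lambda>((x, xb), (y, yb)).
       ell n (x, xb) * (y 1 / yb 1)
     + ell n (x, xb) * (\<Sum>m=2..n-1. (\<Prod>i=1..m-1. y i / x i) * (1 + y m / yb m))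
     + x n * y n * (\<Prod>i=1..n-1. xb i * y i)
     + ell n (y, yb) * (xb 1 / x 1)
     + ell n (y, yb) * (\<Sum>m=2..n-1. (\<Prod>i=1..m-1. xb i / yb i) * (1 + xb m / x m))
     + (\<Prod>i=1..n-1. xb i * y i))"

fun V :: "nat \<Rightarrow> tuple \<times> tuple \<Rightarrow> nat \<Rightarrow> complex" where
  "V n p 0 = V0 n p"
| "V n p (Suc j) =
     (let ((x, xb), (y, yb)) = p; i = Suc j; d = ell n (x, xb) - ell n (y, yb)
      in if i = n - 1
         then yb i / y n * (y n / xb i * V n p j + d * (y n / x i + 1 / yb i))
         else yb i * (1 / xb i * V n p j + d * (1 / x i + 1 / yb i)))"

definition U :: "nat \<Rightarrow> tuple \<times> tuple \<Rightarrow> nat \<Rightarrow> complex" where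
  "U n p i =
     (let ((x, xb), (y, yb)) = p; Vs = V n (sigma_star n p)
      in if i = 1 then V n p 0 * V n (sigma_1 p) 0
         else if i = n - 1 then V n p (n-1) * Vs (n-1)
         else inverse (1 / x i + 1 / yb i) *
                (1 / y i * V n p i * Vs (i-1) + 1 / xb i * V n p (i-1) * Vs i))"

text \<open>
  $R_n$ is a rational map.  Since division by zero yields zero in HOL, it is made a partial
  map, defined exactly where all denominators in the formulas are nonzero and the resulting
  entries are nonzero.
\<close>

definition R_defined :: "nat \<Rightarrow> tuple \<times> tuple \<Rightarrow> bool" where
  "R_defined n p \<longleftrightarrow>
     p \<in> tuples n \<times> tuples n \<and>
     (\<forall>i\<in>{2..n-2}. 1 / fst (fst p) i + 1 / snd (snd p) i \<noteq> 0) \<and>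
     V n (sigma_1 p) 0 \<noteq> 0 \<and>
     V n (sigma_n n p) (n-1) \<noteq> 0 \<and>
     (\<forall>i\<in>{0..n-1}. V n p i \<noteq> 0) \<and>
     (\<forall>i\<in>{1..n-1}. V n (sigma_star n p) i \<noteq> 0) \<and>
     (\<forall>i\<in>{1..n-1}. U n p i \<noteq> 0)"

definition R_formula :: "nat \<Rightarrow> tuple \<times> tuple \<Rightarrow> tuple \<times> tuple" where
  "R_formula n p =
     (let ((x, xb), (y, yb)) = p;
          V' = V n p; Vs = V n (sigma_star n p); U' = U n p;
          V01 = V n (sigma_1 p) 0; Vnn = V n (sigma_n n p) (n-1)
      in ((\<lambda>i\<in>{1..n}. if i = 1 then y 1 * (V01 / V' 1)
                      else if i = n then y n * (V' (n-1) / Vnn)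
                      else y i * (V' (i-1) * U' i / (V' i * U' (i-1))),
           \<lambda>i\<in>{1..n-1}. yb i * (V' (i-1) / V' i)),
          (\<lambda>i\<in>{1..n}. if i = 1 then x 1 * (V' 0 / Vs 1)
                      else if i = n then x n * (Vnn / V' (n-1))
                      else x i * (Vs (i-1) / Vs i),
           \<lambda>i\<in>{1..n-1}. if i = 1 then xb 1 * (V01 / Vs 1)
                      else xb i * (Vs (i-1) * U' i / (Vs i * U' (i-1))))))"

definition trop_R :: "nat \<Rightarrow> tuple \<times> tuple \<rightharpoonup> tuple \<times> tuple" where
  "trop_R n p = (if R_defined n p then Some (R_formula n p) else None)"


section \<open>Reductions\<close>

text \<open>
  The partial map induced by \<open>F\<close> on \<open>A \<times> A\<close> along an embedding \<open>f\<close> of \<open>A\<close>: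
  it sends \<open>p\<close> to the \<open>q\<close> with \<open>F (f \<times> f) p = (f \<times> f) q\<close> (see \<open>pullback_eq_Some_iff\<close> below).
\<close>

definition pullback :: "'a set \<Rightarrow> ('a \<Rightarrow> 'b) \<Rightarrow> ('b \<times> 'b \<rightharpoonup> 'b \<times> 'b) \<Rightarrow> ('a \<times> 'a \<rightharpoonup> 'a \<times> 'a)" where
  "pullback A f F p =
     (if p \<in> A \<times> A \<and> (\<exists>q\<in>A \<times> A. F (map_prod f f p) = Some (map_prod f f q))
      then Some (THE q. q \<in> A \<times> A \<and> F (map_prod f f p) = Some (map_prod f f q))
      else None)"

lemma pullback_eq_Some_iff:
  assumes "inj_on f A"
  shows "pullback A f F p = Some q \<longleftrightarrow>
    p \<in> A \<times> A \<and> q \<in> A \<times> A \<and> F (map_prod f f p) = Some (map_prod f f q)"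
proof -
  have inj: "inj_on (map_prod f f) (A \<times> A)"
    using assms by (intro map_prod_inj_on)
  have the: "(THE q. q \<in> A \<times> A \<and> F (map_prod f f p) = Some (map_prod f f q)) = r"
    if "r \<in> A \<times> A" "F (map_prod f f p) = Some (map_prod f f r)" for r
    using that inj by (intro the_equality) (auto dest: inj_onD)
  show ?thesis
    unfolding pullback_def using the by (auto split: if_splits)
qed

definition tuples_A :: "nat \<Rightarrow> tuple set" where
  "tuples_A m = ({1..m} \<rightarrow>\<^sub>E - {0}) \<times> ({1..m} \<rightarrow>\<^sub>E - {0})"

definition rho_A :: "nat \<Rightarrow> tuple \<Rightarrow> tuple" where
  "rho_A m = (\<lambda>(x, xb). (\<lambda>i\<in>{1..m+1}. if i = m + 1 then 1 else x i, \<lambda>i\<in>{1..m}. xb i))"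

definition trop_R_A :: "nat \<Rightarrow> tuple \<times> tuple \<rightharpoonup> tuple \<times> tuple" where
  "trop_R_A m = pullback (tuples_A m) (rho_A m) (trop_R (m+1))"

text \<open>
  In the $C^{(1)}_m$ case the unbarred entries are $x_0,\dots,x_m$; the entry of index $i$ is
  moved to index $i+1$, and $x_0$ also becomes the barred entry of index 1.
\<close>

definition tuples_C :: "nat \<Rightarrow> tuple set" where
  "tuples_C m = ({0..m} \<rightarrow>\<^sub>E - {0}) \<times> ({1..m} \<rightarrow>\<^sub>E - {0})"

definition rho_C :: "nat \<Rightarrow> tuple \<Rightarrow> tuple" where
  "rho_C m = (\<lambda>(x, xb). (\<lambda>i\<in>{1..m+2}. if i = m + 2 then 1 else x (i-1),
                         \<lambda>i\<in>{1..m+1}. if i = 1 then x 0 else xb (i-1)))"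

definition trop_R_C :: "nat \<Rightarrow> tuple \<times> tuple \<rightharpoonup> tuple \<times> tuple" where
  "trop_R_C m = pullback (tuples_C m) (rho_C m) (trop_R (m+2))"

lemma rho_A_in_tuples: "z \<in> tuples_A m \<Longrightarrow> rho_A m z \<in> tuples (m+1)"
  by (auto simp: tuples_A_def tuples_def rho_A_def PiE_def Pi_def split: if_splits)

lemma rho_C_in_tuples: "z \<in> tuples_C m \<Longrightarrow> rho_C m z \<in> tuples (m+2)"
proof -
  assume z: "z \<in> tuples_C m"
  obtain x xb where zx: "z = (x, xb)" by (metis surj_pair)
  have "x i \<noteq> 0" if "i \<le> m" for i
    using z that by (auto simp: zx tuples_C_def dest: PiE_mem)
  moreover have "xb i \<noteq> 0" if "1 \<le> i" "i \<le> m" for i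
    using z that by (auto simp: zx tuples_C_def dest: PiE_mem)
  ultimately show ?thesis
    by (auto simp: zx tuples_def rho_C_def PiE_iff)
qed

lemma inj_on_rho_A: "inj_on (rho_A m) (tuples_A m)"
proof (rule inj_onI)
  fix z w assume z: "z \<in> tuples_A m" and w: "w \<in> tuples_A m" and eq: "rho_A m z = rho_A m w"
  obtain x xb y yb where zw: "z = (x, xb)" "w = (y, yb)" by (metis surj_pair)
  have fst: "fst (rho_A m z) i = fst (rho_A m w) i" and snd: "snd (rho_A m z) i = snd (rho_A m w) i"
    for i by (simp_all only: eq)
  have "x i = y i" "xb i = yb i" if "i \<in> {1..m}" for i
    using that fst[of i] snd[of i] by (simp_all add: zw rho_A_def)
  moreover have "x \<in> {1..m} \<rightarrow>\<^sub>E - {0}" "y \<in> {1..m} \<rightarrow>\<^sub>E - {0}"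
      "xb \<in> {1..m} \<rightarrow>\<^sub>E - {0}" "yb \<in> {1..m} \<rightarrow>\<^sub>E - {0}"
    using z w by (simp_all add: zw tuples_A_def)
  ultimately have "x = y" "xb = yb" by (blast intro: PiE_ext)+
  then show "z = w" by (simp add: zw)
qed

lemma inj_on_rho_C: "inj_on (rho_C m) (tuples_C m)"
proof (rule inj_onI)
  fix z w assume z: "z \<in> tuples_C m" and w: "w \<in> tuples_C m" and eq: "rho_C m z = rho_C m w"
  obtain x xb y yb where zw: "z = (x, xb)" "w = (y, yb)" by (metis surj_pair)
  have fst: "fst (rho_C m z) i = fst (rho_C m w) i" and snd: "snd (rho_C m z) i = snd (rho_C m w) i"
    for i by (simp_all only: eq)
  have "x i = y i" if "i \<in> {0..m}" for i
    using that fst[of "i + 1"] by (simp add: zw rho_C_def)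
  moreover have "xb i = yb i" if "i \<in> {1..m}" for i
    using that snd[of "i + 1"] by (simp add: zw rho_C_def)
  moreover have "x \<in> {0..m} \<rightarrow>\<^sub>E - {0}" "y \<in> {0..m} \<rightarrow>\<^sub>E - {0}"
      "xb \<in> {1..m} \<rightarrow>\<^sub>E - {0}" "yb \<in> {1..m} \<rightarrow>\<^sub>E - {0}"
    using z w by (simp_all add: zw tuples_C_def)
  ultimately have "x = y" "xb = yb" by (blast intro: PiE_ext)+
  then show "z = w" by (simp add: zw)
qed

lemma trop_R_A_iff:
  "trop_R_A m (x, y) = Some (x', y') \<longleftrightarrow>
     {x, y, x', y'} \<subseteq> tuples_A m \<and>
     trop_R (m+1) (rho_A m x, rho_A m y) = Some (rho_A m x', rho_A m y')"
  by (auto simp: trop_R_A_def pullback_eq_Some_iff[OF inj_on_rho_A])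

lemma trop_R_C_iff:
  "trop_R_C m (x, y) = Some (x', y') \<longleftrightarrow>
     {x, y, x', y'} \<subseteq> tuples_C m \<and>
     trop_R (m+2) (rho_C m x, rho_C m y) = Some (rho_C m x', rho_C m y')"
  by (auto simp: trop_R_C_def pullback_eq_Some_iff[OF inj_on_rho_C])

abbreviation rho_A_inv :: "nat \<Rightarrow> tuple \<Rightarrow> tuple" where
  "rho_A_inv m \<equiv> inv_into (tuples_A m) (rho_A m)"

abbreviation rho_C_inv :: "nat \<Rightarrow> tuple \<Rightarrow> tuple" where
  "rho_C_inv m \<equiv> inv_into (tuples_C m) (rho_C m)"

end

theory Submission
  imports Defs
begin

text \<open>
  Since $x_n=y_n=1$, the involution $\sigma_n$ acts trivially and the two linear recursions for
  $V_i$ and $V_i^{\sigma_\ast}$, which start at the common value $V_0$, also meet again: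
  $V_{n-1}=V_{n-1}^{\sigma_\ast}$.  These conditions determine $V_0$ uniquely, and solving them
  gives the explicit sum that defines $V_0$.  So it is enough to exhibit a solution in terms of
  tau functions.  With $c=(\ell(x)-\ell(y))\beta/\alpha$ it reads
  $V_i=c\,S_i\tau^2_i/(N_i\tau^3_i)$, $V_i^{\sigma_\ast}=c\,E_i\tau^2_i/(W_i\tau^1_i)$ and
  $U_i=c^2\tau^2_i\tau^4_i/(\tau^1_i\tau^3_i)$; the recursions for these three are equivalent to
  $\langle 3,i\rangle$, $\langle 1,i\rangle$ and $\langle 4,i\rangle$, with $\langle 2,i\rangle$
  used to rewrite $1/x_i+1/\bar y_i$.  Finally $\sigma_1$ amounts to exchanging the indices $0$ and
  $1$ of the tau functions, which gives $V_0^{\sigma_1}$.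
\<close>

section \<open>The value of V_0 forced by the two linear recursions\<close>

text \<open>Each recursion telescopes after multiplication by an integrating factor. This expresses
  \<open>v m\<close> through \<open>v 0\<close> in two ways, and comparing them leaves one linear
  equation for \<open>v 0\<close>, with coefficient \<open>d\<close>.\<close>

lemma V0_from_closed_recursion:
  fixes x xb y yb v w :: "nat \<Rightarrow> complex"
  assumes m: "m \<ge> 1"
    and nz: "\<And>i. i \<in> {1..m} \<Longrightarrow> x i \<noteq> 0 \<and> xb i \<noteq> 0 \<and> y i \<noteq> 0 \<and> yb i \<noteq> 0"
    and d: "d = (\<Prod>i=1..m. x i * xb i) - (\<Prod>i=1..m. y i * yb i)" "d \<noteq> 0"
    and v: "\<And>j. j < m \<Longrightarrow> v (Suc j) = yb (Suc j) / xb (Suc j) * v j + d * (yb (Suc j) / x (Suc j) + 1)"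
    and w: "\<And>j. j < m \<Longrightarrow> w (Suc j) = x (Suc j) / y (Suc j) * w j - d * (x (Suc j) / yb (Suc j) + 1)"
    and ends: "v 0 = w 0" "v m = w m"
  shows "v 0 = (\<Prod>i=1..m. x i * xb i) * (y 1 / yb 1 + (\<Sum>i=2..m. (\<Prod>h=1..i-1. y h / x h) * (1 + y i / yb i)))
      + (\<Prod>i=1..m. xb i * y i)
      + (\<Prod>i=1..m. y i * yb i) * (xb 1 / x 1 + (\<Sum>i=2..m. (\<Prod>h=1..i-1. xb h / yb h) * (1 + xb i / x i)))
      + (\<Prod>i=1..m. xb i * y i)"
proof -
  \<comment> \<open>Integrating factors: \<open>P (Suc j) * (yb (Suc j) / xb (Suc j)) = P j\<close>
    and \<open>Q (Suc j) * (x (Suc j) / y (Suc j)) = Q j\<close>.\<close>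
  define P where "P = (\<lambda>j. \<Prod>h=1..j. xb h / yb h)"
  define Q where "Q = (\<lambda>j. \<Prod>h=1..j. y h / x h)"
  have P_Suc: "P (Suc j) = P j * (xb (Suc j) / yb (Suc j))" for j
    by (simp add: P_def)
  have Q_Suc: "Q (Suc j) = Q j * (y (Suc j) / x (Suc j))" for j
    by (simp add: Q_def)
  \<comment> \<open>Each step adds \<open>d\<close> times
    \<open>P j * xb (Suc j) / x (Suc j)\<close> plus \<open>P (Suc j)\<close>. Pairing the second
    half of one step with the first half of the next gives the factors
    \<open>1 + xb i / x i\<close>; the very first and very last halves stay unpaired.\<close>
  have Pv: "P (Suc j) * v (Suc j) = v 0 + d * (xb 1 / x 1
      + (\<Sum>i=2..Suc j. P (i-1) * (1 + xb i / x i)) + P (Suc j))" if "j < m" for j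
    using that
  proof (induction j)
    case 0
    then show ?case
      using v[of 0] nz[of 1] by (simp add: P_def field_simps)
  next
    case (Suc j)
    have "P (Suc (Suc j)) * v (Suc (Suc j)) = P (Suc j) * v (Suc j)
        + d * P (Suc j) * (xb (Suc (Suc j)) / x (Suc (Suc j))) + d * P (Suc (Suc j))"
      unfolding v[OF Suc.prems] P_Suc[of "Suc j"] using nz[of "Suc (Suc j)"] Suc.prems
      by (simp add: field_simps)
    also have "\<dots> = v 0 + d * (xb 1 / x 1
        + ((\<Sum>i=2..Suc j. P (i-1) * (1 + xb i / x i)) + P (Suc j) * (1 + xb (Suc (Suc j)) / x (Suc (Suc j))))
        + P (Suc (Suc j)))"
      using Suc by (simp add: algebra_simps)
    also have "(\<Sum>i=2..Suc j. P (i-1) * (1 + xb i / x i)) + P (Suc j) * (1 + xb (Suc (Suc j)) / x (Suc (Suc j)))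
        = (\<Sum>i=2..Suc (Suc j). P (i-1) * (1 + xb i / x i))"
      by simp
    finally show ?case .
  qed
  have Qw: "Q (Suc j) * w (Suc j) = w 0 - d * (y 1 / yb 1
      + (\<Sum>i=2..Suc j. Q (i-1) * (1 + y i / yb i)) + Q (Suc j))" if "j < m" for j
    using that
  proof (induction j)
    case 0
    then show ?case
      using w[of 0] nz[of 1] by (simp add: Q_def field_simps)
  next
    case (Suc j)
    have "Q (Suc (Suc j)) * w (Suc (Suc j)) = Q (Suc j) * w (Suc j)
        - d * Q (Suc j) * (y (Suc (Suc j)) / yb (Suc (Suc j))) - d * Q (Suc (Suc j))"
      unfolding w[OF Suc.prems] Q_Suc[of "Suc j"] using nz[of "Suc (Suc j)"] Suc.prems
      by (simp add: field_simps)
    also have "\<dots> = w 0 - d * (y 1 / yb 1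
        + ((\<Sum>i=2..Suc j. Q (i-1) * (1 + y i / yb i)) + Q (Suc j) * (1 + y (Suc (Suc j)) / yb (Suc (Suc j))))
        + Q (Suc (Suc j)))"
      using Suc by (simp add: algebra_simps)
    also have "(\<Sum>i=2..Suc j. Q (i-1) * (1 + y i / yb i)) + Q (Suc j) * (1 + y (Suc (Suc j)) / yb (Suc (Suc j)))
        = (\<Sum>i=2..Suc (Suc j). Q (i-1) * (1 + y i / yb i))"
      by simp
    finally show ?case .
  qed
  define X Y Z where "X = (\<Prod>i=1..m. x i * xb i)" and "Y = (\<Prod>i=1..m. y i * yb i)"
    and "Z = (\<Prod>i=1..m. xb i * y i)"
  define A B where "A = xb 1 / x 1 + (\<Sum>i=2..m. P (i-1) * (1 + xb i / x i))"
    and "B = y 1 / yb 1 + (\<Sum>i=2..m. Q (i-1) * (1 + y i / yb i))"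
  \<comment> \<open>Scaling by \<open>Y\<close> and by \<open>X\<close> turns the two integrating
    factors at \<open>m\<close> into the same product \<open>Z\<close>, which makes the two
    relations comparable.\<close>
  have YP: "Y * P m = Z" and XQ: "X * Q m = Z"
    unfolding X_def Y_def Z_def P_def Q_def prod.distrib[symmetric] using nz
    by (auto intro!: prod.cong)
  have Pv': "P m * v m = v 0 + d * (A + P m)" and Qw': "Q m * v m = v 0 - d * (B + Q m)"
    using Pv[of "m-1"] Qw[of "m-1"] m ends by (simp_all add: A_def B_def)
  have "Z * v m = Y * v 0 + d * (Y * A + Z)"
    using arg_cong[OF Pv', of "\<lambda>z. Y * z"] by (simp add: YP[symmetric] algebra_simps)
  moreover have "Z * v m = X * v 0 - d * (X * B + Z)"
    using arg_cong[OF Qw', of "\<lambda>z. X * z"] by (simp add: XQ[symmetric] algebra_simps)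
  ultimately have eq: "Y * v 0 + d * (Y * A + Z) = X * v 0 - d * (X * B + Z)"
    by simp
  \<comment> \<open>Since \<open>d = X - Y\<close>, the coefficient of \<open>v 0\<close> in
    \<open>eq\<close> is \<open>d\<close> itself, which then cancels.\<close>
  have "d * v 0 = X * v 0 - Y * v 0"
    by (simp add: d(1) X_def Y_def left_diff_distrib)
  also have "\<dots> = d * (X * B + Z + Y * A + Z)"
    using eq by (simp add: algebra_simps)
  finally have "d * v 0 = d * (X * B + Z + Y * A + Z)" .
  then show ?thesis
    using d(2) unfolding X_def Y_def Z_def A_def B_def P_def Q_def by simp
qed

section \<open>The chain of bilinear equations and its closed-form solution\<close>

text \<open>
  The bilinear equations with all boundary cases brought to the generic form; the sequences are
  indexed by $0,\dots,m$ with $m=n-1$, and the assumptions \<open>ends\<close> are what remains of the boundary.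
\<close>

locale bilinear_chain =
  fixes m :: nat and a b :: complex
    and l lb k kb W N S E T0 T1 T2 T3 T4 :: "nat \<Rightarrow> complex"
  assumes m_pos: "m \<ge> 1"
    and ab_nz: "a \<noteq> 0" "b \<noteq> 0"
    and C_nz: "\<And>i. i \<le> m \<Longrightarrow> W i \<noteq> 0 \<and> N i \<noteq> 0 \<and> S i \<noteq> 0 \<and> E i \<noteq> 0"
    and T_nz: "\<And>i. i \<le> m \<Longrightarrow> T1 i \<noteq> 0 \<and> T2 i \<noteq> 0 \<and> T3 i \<noteq> 0 \<and> T4 i \<noteq> 0"
    and T0_nz: "\<And>i. i < m \<Longrightarrow> T0 (Suc i) \<noteq> 0"
    and kl_nz: "\<And>i. i < m \<Longrightarrow> l (Suc i) \<noteq> 0 \<and> lb (Suc i) \<noteq> 0 \<and> k (Suc i) \<noteq> 0 \<and> kb (Suc i) \<noteq> 0"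
    and bil1: "\<And>i. i < m \<Longrightarrow> k (Suc i) * E i * N (Suc i) - l (Suc i) * N i * E (Suc i)
                = a * T0 (Suc i) * T1 (Suc i)"
    and bil2: "\<And>i. i < m \<Longrightarrow> kb (Suc i) * W i * N (Suc i) + l (Suc i) * N i * W (Suc i)
                = b * T0 (Suc i) * T2 (Suc i)"
    and bil3: "\<And>i. i < m \<Longrightarrow> kb (Suc i) * W i * S (Suc i) - lb (Suc i) * S i * W (Suc i)
                = a * T0 (Suc i) * T3 (Suc i)"
    and bil4: "\<And>i. i < m \<Longrightarrow> k (Suc i) * E i * S (Suc i) + lb (Suc i) * S i * E (Suc i)
                = b * T0 (Suc i) * T4 (Suc i)"
    and ends: "i \<in> {0, m} \<Longrightarrow> (W i)\<^sup>2 = T3 i * T2 i" "i \<in> {0, m} \<Longrightarrow> (N i)\<^sup>2 = T2 i * T1 i"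
      "i \<in> {0, m} \<Longrightarrow> S i * W i * T1 i = E i * N i * T3 i"
      "i \<in> {0, m} \<Longrightarrow> S i * E i * T2 i = T4 i * N i * W i"
    and ell_neq: "(\<Prod>i=1..m. l i * lb i) \<noteq> (\<Prod>i=1..m. k i * kb i)"
begin

text \<open>The generic entries of [lambda; tau^3, W, tau^2] and, for \<open>y\<close> and
  \<open>yb\<close>, of [kappa; tau^2, N, tau^1], now used at every index from 1 to m.\<close>

definition "x i = W (i-1) * T2 i / (l i * W i * T2 (i-1))"
definition "xb i = W (i-1) * T3 i / (lb i * W i * T3 (i-1))"
definition "y i = N (i-1) * T1 i / (k i * N i * T1 (i-1))"
definition "yb i = N (i-1) * T2 i / (kb i * N i * T2 (i-1))"

definition "d = (\<Prod>i=1..m. x i * xb i) - (\<Prod>i=1..m. y i * yb i)"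
definition "c = d * b / a"
definition "v i = c * (S i * T2 i / (N i * T3 i))"
definition "w i = c * (E i * T2 i / (W i * T1 i))"
definition "u i = c\<^sup>2 * (T2 i * T4 i / (T1 i * T3 i))"

lemma nz_step:
  assumes "j < m"
  shows "W j \<noteq> 0" "N j \<noteq> 0" "S j \<noteq> 0" "E j \<noteq> 0" "T1 j \<noteq> 0" "T2 j \<noteq> 0" "T3 j \<noteq> 0" "T4 j \<noteq> 0"
    "W (Suc j) \<noteq> 0" "N (Suc j) \<noteq> 0" "S (Suc j) \<noteq> 0" "E (Suc j) \<noteq> 0"
    "T1 (Suc j) \<noteq> 0" "T2 (Suc j) \<noteq> 0" "T3 (Suc j) \<noteq> 0" "T4 (Suc j) \<noteq> 0" "T0 (Suc j) \<noteq> 0"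
    "l (Suc j) \<noteq> 0" "lb (Suc j) \<noteq> 0" "k (Suc j) \<noteq> 0" "kb (Suc j) \<noteq> 0"
  using C_nz[of j] T_nz[of j] C_nz[of "Suc j"] T_nz[of "Suc j"] T0_nz[of j] kl_nz[of j] assms by auto

lemma xy_nz: "i \<in> {1..m} \<Longrightarrow> x i \<noteq> 0 \<and> xb i \<noteq> 0 \<and> y i \<noteq> 0 \<and> yb i \<noteq> 0"
  by (cases i) (simp_all add: x_def xb_def y_def yb_def nz_step)

text \<open>The quotients telescope, and the first relation of \<open>ends\<close> at 0 and m
  cancels the two remaining boundary factors. Together with \<open>prod_y\<close> this shows that
  \<open>d\<close> depends on lambda and kappa only.\<close>

lemma prod_x: "(\<Prod>i=1..m. x i * xb i) = 1 / (\<Prod>i=1..m. l i * lb i)"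
proof -
  have "(\<Prod>i=1..j. x i * xb i) = (W 0)\<^sup>2 * (T2 j * T3 j) / ((\<Prod>i=1..j. l i * lb i) * (W j)\<^sup>2 * (T2 0 * T3 0))"
    if "j \<le> m" for j
    using that
  proof (induction j)
    case 0
    then show ?case using C_nz[of 0] T_nz[of 0] by simp
  next
    case (Suc j)
    then show ?case using nz_step[of j]
      by (simp add: x_def xb_def power2_eq_square mult_ac)
  qed
  from this[of m] show ?thesis
    using ends(1)[of 0] ends(1)[of m] T_nz[of 0] T_nz[of m] by (simp add: mult.commute)
qed

lemma prod_y: "(\<Prod>i=1..m. y i * yb i) = 1 / (\<Prod>i=1..m. k i * kb i)"
proof -
  have "(\<Prod>i=1..j. y i * yb i) = (N 0)\<^sup>2 * (T1 j * T2 j) / ((\<Prod>i=1..j. k i * kb i) * (N j)\<^sup>2 * (T1 0 * T2 0))"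
    if "j \<le> m" for j
    using that
  proof (induction j)
    case 0
    then show ?case using C_nz[of 0] T_nz[of 0] by simp
  next
    case (Suc j)
    then show ?case using nz_step[of j]
      by (simp add: y_def yb_def power2_eq_square mult_ac)
  qed
  from this[of m] show ?thesis
    using ends(2)[of 0] ends(2)[of m] T_nz[of 0] T_nz[of m] by (simp add: mult.commute)
qed

lemma d_nz: "d \<noteq> 0"
  using ell_neq unfolding d_def prod_x prod_y by simp

lemma c_nz: "c \<noteq> 0"
  using d_nz ab_nz by (simp add: c_def)

lemma vwu_nz: "i \<le> m \<Longrightarrow> v i \<noteq> 0 \<and> w i \<noteq> 0 \<and> u i \<noteq> 0"
  using C_nz[of i] T_nz[of i] c_nz by (simp add: v_def w_def u_def)

lemma yb_x_plus_1:
  assumes "j < m"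
  shows "yb (Suc j) / x (Suc j) + 1 = b * T0 (Suc j) * T2 (Suc j) / (kb (Suc j) * N (Suc j) * W j)"
  unfolding bil2[OF assms, symmetric] using nz_step[OF assms]
  by (simp add: x_def yb_def field_simps)

lemma x_yb_plus_1:
  assumes "j < m"
  shows "x (Suc j) / yb (Suc j) + 1 = b * T0 (Suc j) * T2 (Suc j) / (l (Suc j) * N j * W (Suc j))"
  unfolding bil2[OF assms, symmetric] using nz_step[OF assms]
  by (simp add: x_def yb_def field_simps)

text \<open>The difference of the two \<open>v\<close> terms contains the left side of
  \<open>bil3\<close> and so contributes a factor \<open>a\<close>; the bracket contributes
  \<open>b\<close> through \<open>bil2\<close>. The constant \<open>c = d * b / a\<close> is what
  balances the two.\<close>

lemma v_step:
  assumes "j < m"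
  shows "v (Suc j) = yb (Suc j) / xb (Suc j) * v j + d * (yb (Suc j) / x (Suc j) + 1)"
proof -
  have "v (Suc j) - yb (Suc j) / xb (Suc j) * v j
      = c * (kb (Suc j) * W j * S (Suc j) - lb (Suc j) * S j * W (Suc j))
        * (T2 (Suc j) / (N (Suc j) * T3 (Suc j) * kb (Suc j) * W j))"
    using nz_step[OF assms] by (simp add: v_def xb_def yb_def divide_simps) (simp add: algebra_simps)
  also have "\<dots> = d * (yb (Suc j) / x (Suc j) + 1)"
    unfolding bil3[OF assms] yb_x_plus_1[OF assms] c_def
    using nz_step[OF assms] ab_nz by (simp add: mult_ac)
  finally show ?thesis by (simp add: algebra_simps)
qed

text \<open>The same balance with \<open>bil1\<close> in place of \<open>bil3\<close>. The sign of
  \<open>d\<close> is reversed because \<open>sigma_star\<close> exchanges the roles of ell(x) and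
  ell(y).\<close>

lemma w_step:
  assumes "j < m"
  shows "w (Suc j) = x (Suc j) / y (Suc j) * w j - d * (x (Suc j) / yb (Suc j) + 1)"
proof -
  have "x (Suc j) / y (Suc j) * w j - w (Suc j)
      = c * (k (Suc j) * E j * N (Suc j) - l (Suc j) * N j * E (Suc j))
        * (T2 (Suc j) / (W (Suc j) * T1 (Suc j) * l (Suc j) * N j))"
    using nz_step[OF assms] by (simp add: w_def x_def y_def divide_simps) (simp add: algebra_simps)
  also have "\<dots> = d * (x (Suc j) / yb (Suc j) + 1)"
    unfolding bil1[OF assms] x_yb_plus_1[OF assms] c_def
    using nz_step[OF assms] ab_nz by (simp add: mult_ac)
  finally show ?thesis by (simp add: algebra_simps)
qed

lemma inverse_x_yb:
  assumes "j < m"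
  shows "1 / x (Suc j) + 1 / yb (Suc j) = b * T0 (Suc j) * T2 j / (N j * W j)"
proof -
  have "1 / x (Suc j) + 1 / yb (Suc j) = (yb (Suc j) / x (Suc j) + 1) / yb (Suc j)"
    using xy_nz[of "Suc j"] assms by (simp add: field_simps)
  then show ?thesis
    unfolding yb_x_plus_1[OF assms] using nz_step[OF assms] by (simp add: yb_def mult_ac)
qed

lemma inverse_x_yb_nz: "j < m \<Longrightarrow> 1 / x (Suc j) + 1 / yb (Suc j) \<noteq> 0"
  by (simp add: inverse_x_yb nz_step ab_nz)

text \<open>The factor \<open>b\<close> from \<open>bil4\<close> cancels the \<open>b\<close> in
  \<open>inverse_x_yb\<close>, so \<open>u\<close> carries only the square of \<open>c\<close>
  coming from the products of \<open>v\<close> and \<open>w\<close>.\<close>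

lemma u_step:
  assumes "j < m"
  shows "u (Suc j) = inverse (1 / x (Suc j) + 1 / yb (Suc j))
    * (1 / y (Suc j) * v (Suc j) * w j + 1 / xb (Suc j) * v j * w (Suc j))"
proof -
  have "1 / y (Suc j) * v (Suc j) * w j + 1 / xb (Suc j) * v j * w (Suc j)
      = c\<^sup>2 * (k (Suc j) * E j * S (Suc j) + lb (Suc j) * S j * E (Suc j))
        * (T2 (Suc j) * T2 j / (N j * W j * T1 (Suc j) * T3 (Suc j)))"
    using nz_step[OF assms]
    by (simp add: v_def w_def y_def xb_def divide_simps) (simp add: algebra_simps power2_eq_square)
  also have "\<dots> = (1 / x (Suc j) + 1 / yb (Suc j)) * u (Suc j)"
    unfolding bil4[OF assms] inverse_x_yb[OF assms] u_def by (simp add: mult_ac)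
  finally show ?thesis
    using inverse_x_yb_nz[OF assms] by simp
qed

text \<open>The third relation of \<open>ends\<close> says that \<open>S i / (N i * T3 i)\<close>
  and \<open>E i / (W i * T1 i)\<close> agree at both ends.\<close>

lemma v_ends: "v 0 = w 0" "v m = w m"
proof -
  have "v i = w i" if "i \<in> {0, m}" for i
  proof -
    have "i \<le> m" using that by auto
    then have "v i = c * T2 i * (S i * W i * T1 i) / (N i * T3 i * W i * T1 i)"
      using C_nz[of i] T_nz[of i] by (simp add: v_def)
    also have "\<dots> = w i"
      using C_nz[of i] T_nz[of i] \<open>i \<le> m\<close> unfolding ends(3)[OF that] by (simp add: w_def)
    finally show ?thesis .
  qed
  then show "v 0 = w 0" "v m = w m" by simp_all
qed

text \<open>At m this matches the exceptional definition of U_{n-1}. At 0 it supplies a value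
  playing the role of the missing U_0, which lets the formulas of R at index 1 be read as generic
  ones.\<close>

lemma u_ends: "u 0 = v 0 * w 0" "u m = v m * w m"
proof -
  have "v i * w i = u i" if "i \<in> {0, m}" for i
  proof -
    have "i \<le> m" using that by auto
    then have "v i * w i = c\<^sup>2 * T2 i * (S i * E i * T2 i) / (N i * T3 i * W i * T1 i)"
      using C_nz[of i] T_nz[of i] by (simp add: v_def w_def power2_eq_square mult_ac)
    also have "\<dots> = u i"
      using C_nz[of i] T_nz[of i] \<open>i \<le> m\<close> unfolding ends(4)[OF that] by (simp add: u_def)
    finally show ?thesis .
  qed
  then show "u 0 = v 0 * w 0" "u m = v m * w m" by simp_all
qed

text \<open>In this and the next three quotients \<open>c\<close> cancels, and what remains are the
  generic entries of [kappa; tau^3, S, tau^4] and [lambda; tau^4, E, tau^1].\<close>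

lemma step_x': "j < m \<Longrightarrow> y (Suc j) * (v j * u (Suc j) / (v (Suc j) * u j))
    = S j * T4 (Suc j) / (k (Suc j) * S (Suc j) * T4 j)"
  using nz_step[of j] c_nz by (simp add: y_def v_def u_def divide_simps)

lemma step_xb': "j < m \<Longrightarrow> yb (Suc j) * (v j / v (Suc j))
    = S j * T3 (Suc j) / (kb (Suc j) * S (Suc j) * T3 j)"
  using nz_step[of j] c_nz by (simp add: yb_def v_def divide_simps)

lemma step_y': "j < m \<Longrightarrow> x (Suc j) * (w j / w (Suc j))
    = E j * T1 (Suc j) / (l (Suc j) * E (Suc j) * T1 j)"
  using nz_step[of j] c_nz by (simp add: x_def w_def divide_simps)

lemma step_yb': "j < m \<Longrightarrow> xb (Suc j) * (w j * u (Suc j) / (w (Suc j) * u j))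
    = E j * T4 (Suc j) / (lb (Suc j) * E (Suc j) * T4 j)"
  using nz_step[of j] c_nz by (simp add: xb_def w_def u_def divide_simps)

end

section \<open>Evaluation of \<open>ell\<close> and V_0, in particular for x_n = y_n = 1\<close>

lemma ell_cong:
  assumes "\<And>i. i \<in> {1..n} \<Longrightarrow> x i = x' i" "\<And>i. i \<in> {1..n-1} \<Longrightarrow> xb i = xb' i"
  shows "ell n (x, xb) = ell n (x', xb')"
  using assms by (simp add: ell_def)

lemma ell_reduced:
  assumes "n \<ge> 1" "x n = 1"
  shows "ell n (x, xb) = (\<Prod>i=1..n-1. x i * xb i)"
proof -
  obtain m where "n = Suc m" using assms(1) by (cases n) auto
  then show ?thesis using assms(2) by (simp add: ell_def prod.distrib)
qed

text \<open>Restricted functions, such as those produced by \<open>sigma_star\<close>, are undefined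
  off their index range; V_0 reads only entries inside it, so they may be replaced by total
  expressions.\<close>

lemma V0_cong:
  assumes "n \<ge> 2" "\<And>i. i \<in> {1..n} \<Longrightarrow> x i = x' i" "\<And>i. i \<in> {1..n-1} \<Longrightarrow> xb i = xb' i"
    and "\<And>i. i \<in> {1..n} \<Longrightarrow> y i = y' i" "\<And>i. i \<in> {1..n-1} \<Longrightarrow> yb i = yb' i"
  shows "V0 n ((x, xb), (y, yb)) = V0 n ((x', xb'), (y', yb'))"
proof -
  have "(\<Prod>i=1..m-1. y i / x i) = (\<Prod>i=1..m-1. y' i / x' i)"
    "(\<Prod>i=1..m-1. xb i / yb i) = (\<Prod>i=1..m-1. xb' i / yb' i)"
    "y m = y' m" "yb m = yb' m" "x m = x' m" "xb m = xb' m" if "m \<in> {2..n-1}" for m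
    using that assms(2-5) by (auto intro!: prod.cong)
  moreover have "ell n (x, xb) = ell n (x', xb')" "ell n (y, yb) = ell n (y', yb')"
    using assms by (auto intro!: ell_cong)
  moreover have "(\<Prod>i=1..n-1. xb i * y i) = (\<Prod>i=1..n-1. xb' i * y' i)"
    using assms by (auto intro!: prod.cong)
  ultimately show ?thesis
    using assms by (simp add: V0_def cong: sum.cong_simp)
qed

text \<open>Brings V_0 to the shape of the conclusion of \<open>V0_from_closed_recursion\<close>:
  \<open>ell\<close> loses its factor of index n, and both separate products become equal.\<close>

lemma V0_reduced:
  assumes "n \<ge> 1" "x n = 1" "y n = 1"
  shows "V0 n ((x, xb), (y, yb)) =
      (\<Prod>i=1..n-1. x i * xb i) * (y 1 / yb 1 + (\<Sum>i=2..n-1. (\<Prod>h=1..i-1. y h / x h) * (1 + y i / yb i)))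
      + (\<Prod>i=1..n-1. xb i * y i)
      + (\<Prod>i=1..n-1. y i * yb i) * (xb 1 / x 1 + (\<Sum>i=2..n-1. (\<Prod>h=1..i-1. xb h / yb h) * (1 + xb i / x i)))
      + (\<Prod>i=1..n-1. xb i * y i)"
  using assms by (simp add: V0_def ell_reduced algebra_simps)

section \<open>The tropical R evaluated on a chain\<close>

context bilinear_chain
begin

text \<open>Agreement with the chain is asked only on 1..m because the tuples carry a further entry
  1 at index n, which the chain formulas do not describe.\<close>

lemma V0_eq:
  assumes "X n = 1" "Y n = 1" "n = Suc m"
    and "\<And>i. i \<in> {1..m} \<Longrightarrow> X i = x i" "\<And>i. i \<in> {1..m} \<Longrightarrow> Xb i = xb i"
    and "\<And>i. i \<in> {1..m} \<Longrightarrow> Y i = y i" "\<And>i. i \<in> {1..m} \<Longrightarrow> Yb i = yb i"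
  shows "V0 n ((X, Xb), (Y, Yb)) = v 0"
proof -
  have nz: "X i \<noteq> 0 \<and> Xb i \<noteq> 0 \<and> Y i \<noteq> 0 \<and> Yb i \<noteq> 0" if "i \<in> {1..m}" for i
    using xy_nz[OF that] assms that by simp
  have d: "d = (\<Prod>i=1..m. X i * Xb i) - (\<Prod>i=1..m. Y i * Yb i)"
    using assms by (simp add: d_def)
  have v: "v (Suc j) = Yb (Suc j) / Xb (Suc j) * v j + d * (Yb (Suc j) / X (Suc j) + 1)" if "j < m" for j
    using v_step[OF that] assms that by simp
  have w: "w (Suc j) = X (Suc j) / Y (Suc j) * w j - d * (X (Suc j) / Yb (Suc j) + 1)" if "j < m" for j
    using w_step[OF that] assms that by simp
  show ?thesis
    using V0_from_closed_recursion[OF m_pos nz d d_nz v w v_ends] V0_reduced[of n X Y Xb Yb] assms(1-3)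
    by simp
qed

text \<open>Everything in R except V_0^{sigma_1} has a closed form in the chain. That value needs
  the data with indices 0 and 1 exchanged, so it enters as the hypothesis \<open>sig\<close>; its
  form is the one dictated by U_1 = V_0 V_0^{sigma_1}.\<close>

lemma trop_R_eq:
  assumes n: "n = Suc m" "m \<ge> 2"
    and X: "(X, Xb) \<in> tuples n" "X n = 1"
      "\<And>i. i \<in> {1..m} \<Longrightarrow> X i = x i" "\<And>i. i \<in> {1..m} \<Longrightarrow> Xb i = xb i"
    and Y: "(Y, Yb) \<in> tuples n" "Y n = 1"
      "\<And>i. i \<in> {1..m} \<Longrightarrow> Y i = y i" "\<And>i. i \<in> {1..m} \<Longrightarrow> Yb i = yb i"
    and sig: "V n (sigma_1 ((X, Xb), (Y, Yb))) 0 = u 1 / v 0"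
  shows "trop_R n ((X, Xb), (Y, Yb)) = Some
    ((\<lambda>i\<in>{1..n}. if i = n then 1 else S (i-1) * T4 i / (k i * S i * T4 (i-1)),
      \<lambda>i\<in>{1..n-1}. S (i-1) * T3 i / (kb i * S i * T3 (i-1))),
     (\<lambda>i\<in>{1..n}. if i = n then 1 else E (i-1) * T1 i / (l i * E i * T1 (i-1)),
      \<lambda>i\<in>{1..n-1}. E (i-1) * T4 i / (lb i * E i * T4 (i-1))))"
proof -
  define p where "p = ((X, Xb), (Y, Yb))"
  have V0: "V0 n p = v 0"
    unfolding p_def using assms by (intro V0_eq) auto
  have d: "ell n (X, Xb) - ell n (Y, Yb) = d"
    using n X Y by (simp add: ell_reduced d_def)
  have V: "V n p j = v j" if "j \<le> m" for j
    using that
  proof (induction j)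
    case 0
    then show ?case by (simp add: V0)
  next
    case (Suc j)
    have nz: "x (Suc j) \<noteq> 0" "xb (Suc j) \<noteq> 0" "yb (Suc j) \<noteq> 0"
      using xy_nz[of "Suc j"] Suc.prems by auto
    \<comment> \<open>With y_n = 1 the exceptional recursion at index n - 1 coincides with the
      generic one.\<close>
    have "V n p (Suc j) = Yb (Suc j) * (1 / Xb (Suc j) * V n p j + d * (1 / X (Suc j) + 1 / Yb (Suc j)))"
      using Y(2) n unfolding p_def by (simp add: Let_def d[unfolded n(1)])
    also have "\<dots> = v (Suc j)"
      unfolding v_step[OF Suc_le_lessD[OF Suc.prems]] using Suc nz X Y by (simp add: field_simps)
    finally show ?case .
  qed
  define p' where "p' = sigma_star n p"
  have p': "p' = ((\<lambda>i\<in>{1..n}. if i = n then Y n else Yb i, \<lambda>i\<in>{1..n-1}. Y i),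
      (\<lambda>i\<in>{1..n}. if i = n then X n else Xb i, \<lambda>i\<in>{1..n-1}. X i))"
    by (simp add: p'_def p_def sigma_star_def)
  have d': "ell n (fst p') - ell n (snd p') = - d"
    using n X Y by (simp add: p' ell_reduced d_def mult.commute)
  \<comment> \<open>\<open>sigma_star\<close> interchanges the two halves of V_0, so V_0 is
    invariant.\<close>
  have Vs0: "V0 n p' = v 0"
  proof -
    have "V0 n p' = V0 n ((\<lambda>i. if i = n then Y n else Yb i, Y), (\<lambda>i. if i = n then X n else Xb i, X))"
      unfolding p' using n by (intro V0_cong) auto
    also have "\<dots> = V0 n p"
    proof -
      have "(\<Prod>h=1..i-1. (if h = n then X n else Xb h) / (if h = n then Y n else Yb h))
          = (\<Prod>h=1..i-1. Xb h / Yb h)" if "i \<in> {2..n-1}" for i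
        using that by (intro prod.cong) auto
      then show ?thesis
        unfolding p_def using n X(2) Y(2) by (simp add: V0_reduced mult.commute cong: sum.cong_simp)
    qed
    finally show ?thesis by (simp add: V0)
  qed
  have Vs: "V n p' j = w j" if "j \<le> m" for j
    using that
  proof (induction j)
    case 0
    then show ?case by (simp add: Vs0 v_ends)
  next
    case (Suc j)
    have nz: "x (Suc j) \<noteq> 0" "y (Suc j) \<noteq> 0" "yb (Suc j) \<noteq> 0"
      using xy_nz[of "Suc j"] Suc.prems by auto
    have "V n p' (Suc j) = X (Suc j) * (1 / Y (Suc j) * V n p' j - d * (1 / Yb (Suc j) + 1 / X (Suc j)))"
      using X(2) n Suc.prems d' by (simp add: p' Let_def)
    also have "\<dots> = w (Suc j)"
      unfolding w_step[OF Suc_le_lessD[OF Suc.prems]] using Suc nz X Y by (simp add: field_simps)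
    finally show ?case .
  qed
  have sn: "sigma_n n p = p"
    using X(2) Y(2) by (auto simp: sigma_n_def p_def Let_def fun_eq_iff)
  have sig': "V n (sigma_1 p) 0 = u 1 / v 0" using sig by (simp add: p_def)
  have U: "U n p i = u i" if i: "i \<in> {1..m}" for i
  proof -
    have "U n p i = (if i = 1 then V n p 0 * V n (sigma_1 p) 0
         else if i = n - 1 then V n p (n-1) * V n p' (n-1)
         else inverse (1 / X i + 1 / Yb i) *
                (1 / Y i * V n p i * V n p' (i-1) + 1 / Xb i * V n p (i-1) * V n p' i))"
      unfolding p'_def by (simp add: U_def p_def Let_def)
    also have "\<dots> = u i"
    proof -
      obtain j where j: "i = Suc j" "j < m" using i by (cases i) auto
      then show ?thesis
        unfolding sig' using n X Y V[of i] Vs[of i] V[of j] Vs[of j] V[of m] Vs[of m] u_step[of j] u_ends vwu_nz[of 0]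
          V[of 0]
        by auto
    qed
    finally show ?thesis .
  qed
  \<comment> \<open>All denominators are covered by the closed forms, which are nonzero, and by
    \<open>inverse_x_yb_nz\<close>.\<close>
  have R: "R_defined n p"
    unfolding R_defined_def sn sig' p'_def[symmetric]
  proof (intro conjI ballI)
    show "p \<in> tuples n \<times> tuples n" using X Y by (simp add: p_def)
    fix i assume "i \<in> {2..n-2}"
    then obtain j where "i = Suc j" "j < m" using n by (cases i) auto
    then show "1 / fst (fst p) i + 1 / snd (snd p) i \<noteq> 0"
      using inverse_x_yb_nz[of j] X Y by (simp add: p_def)
  qed (use n V Vs U vwu_nz in \<open>auto\<close>)
  have "R_formula n p =
    ((\<lambda>i\<in>{1..n}. if i = n then 1 else S (i-1) * T4 i / (k i * S i * T4 (i-1)),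
      \<lambda>i\<in>{1..n-1}. S (i-1) * T3 i / (kb i * S i * T3 (i-1))),
     (\<lambda>i\<in>{1..n}. if i = n then 1 else E (i-1) * T1 i / (l i * E i * T1 (i-1)),
      \<lambda>i\<in>{1..n-1}. E (i-1) * T4 i / (lb i * E i * T4 (i-1))))"
  proof -
    \<comment> \<open>These identities bring index 1 into generic form: \<open>u 1 / v 0\<close>
      equals \<open>v 0 * u 1 / u 0\<close> and also \<open>w 0 * u 1 / u 0\<close>.\<close>
    have u0: "u 0 = v 0 * v 0" "w 0 = v 0" using u_ends v_ends by simp_all
    have nz: "v 0 \<noteq> 0" "v m \<noteq> 0" using vwu_nz by auto
    note [simp del] = V.simps
    have idx [consumes 1]: thesis if "i \<in> {1..n}" "i = n \<Longrightarrow> thesis" "i = Suc 0 \<Longrightarrow> thesis"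
      "\<And>h. i = Suc (Suc h) \<Longrightarrow> Suc h < m \<Longrightarrow> thesis" for i thesis
    proof (cases i)
      case 0
      then show ?thesis using that(1) by simp
    next
      case (Suc j)
      then show ?thesis using that n(1) by (cases j; cases "i = n") auto
    qed
    have R: "R_formula n p = ((\<lambda>i\<in>{1..n}. if i = 1 then Y 1 * (V n (sigma_1 p) 0 / V n p 1)
           else if i = n then Y n * (V n p (n-1) / V n (sigma_n n p) (n-1))
           else Y i * (V n p (i-1) * U n p i / (V n p i * U n p (i-1))),
        \<lambda>i\<in>{1..n-1}. Yb i * (V n p (i-1) / V n p i)),
       (\<lambda>i\<in>{1..n}. if i = 1 then X 1 * (V n p 0 / V n p' 1)
           else if i = n then X n * (V n (sigma_n n p) (n-1) / V n p (n-1))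
           else X i * (V n p' (i-1) / V n p' i),
        \<lambda>i\<in>{1..n-1}. if i = 1 then Xb 1 * (V n (sigma_1 p) 0 / V n p' 1)
           else Xb i * (V n p' (i-1) * U n p i / (V n p' i * U n p (i-1)))))"
      unfolding R_formula_def p'_def by (simp only: p_def Let_def prod.case)
    have a1: "(if i = 1 then Y 1 * (V n (sigma_1 p) 0 / V n p 1)
           else if i = n then Y n * (V n p (n-1) / V n (sigma_n n p) (n-1))
           else Y i * (V n p (i-1) * U n p i / (V n p i * U n p (i-1))))
         = (if i = n then 1 else S (i-1) * T4 i / (k i * S i * T4 (i-1)))" if "i \<in> {1..n}" for i
      using that
    proof (cases rule: idx)
      case 2
      then show ?thesis
        unfolding sig' using n V[of 1] Y(3)[of 1] u0 nz step_x'[of 0] by (simp add: mult.commute)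
    qed (use n V U Y nz step_x' in \<open>simp_all add: sn[unfolded n(1)]\<close>)
    have a2: "Yb i * (V n p (i-1) / V n p i) = S (i-1) * T3 i / (kb i * S i * T3 (i-1))"
      if "i \<in> {1..n-1}" for i
      using step_xb'[of "i-1"] that n V[of i] V[of "i-1"] Y by auto
    have b1: "(if i = 1 then X 1 * (V n p 0 / V n p' 1)
           else if i = n then X n * (V n (sigma_n n p) (n-1) / V n p (n-1))
           else X i * (V n p' (i-1) / V n p' i))
         = (if i = n then 1 else E (i-1) * T1 i / (l i * E i * T1 (i-1)))" if "i \<in> {1..n}" for i
      using that
    proof (cases rule: idx)
      case 2
      then show ?thesis
        using n V[of 0] Vs[of 1] X(3)[of 1] u0 step_y'[of 0] by simp
    qed (use n V Vs X nz step_y' in \<open>simp_all add: sn[unfolded n(1)]\<close>)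
    have b2: "(if i = 1 then Xb 1 * (V n (sigma_1 p) 0 / V n p' 1)
           else Xb i * (V n p' (i-1) * U n p i / (V n p' i * U n p (i-1))))
         = E (i-1) * T4 i / (lb i * E i * T4 (i-1))" if i: "i \<in> {1..n-1}" for i
    proof -
      have "i \<in> {1..n}" using i by auto
      then show ?thesis
      proof (cases rule: idx)
        case 2
        then show ?thesis
          unfolding sig' using n Vs[of 1] X(4)[of 1] u0 nz step_yb'[of 0] by (simp add: mult.commute)
      qed (use i n Vs U X step_yb' in \<open>simp_all\<close>)
    qed
    show ?thesis
      unfolding R by (intro arg_cong2[where f = Pair] restrict_ext a1 a2 b1 b2)
  qed
  with R show ?thesis
    by (simp add: trop_R_def p_def)
qed

end

section \<open>Folding the reduced data into a chain\<close>

text \<open>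
  With $\tau_{n-1}=\tau_n$ and $\tau'_{n-1}=\tau'_n$, the exceptional formulas for the indices
  $1$, $2$, $n-1$ in the parameterization and in the bilinear equations become instances of the
  generic ones once $\tau$ and $C$ are replaced by the following sequences on $0,\dots,n-1$
  (the equations at $1$ and $n-1$ get multiplied by a tau function); $\tau^0$ is left as it is.
\<close>

definition fold_tau :: "nat \<Rightarrow> (nat \<Rightarrow> complex) \<Rightarrow> nat \<Rightarrow> complex" where
  "fold_tau n t i = (if i = 0 then (t 0)\<^sup>2 else if i = 1 then t 0 * t 1
     else if i = n - 1 then (t (n-1))\<^sup>2 else t i)"

definition fold_C :: "nat \<Rightarrow> (nat \<Rightarrow> complex) \<Rightarrow> (nat \<Rightarrow> complex) \<Rightarrow> (nat \<Rightarrow> complex) \<Rightarrow> nat \<Rightarrow> complex" where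
  "fold_C n C t t' i = (if i = 0 then t 0 * t' 0 else if i = n - 1 then t (n-1) * t' (n-1) else C i)"

lemma fold_tau_nz: "(\<And>i. i \<le> n \<Longrightarrow> t i \<noteq> 0) \<Longrightarrow> n \<ge> 1 \<Longrightarrow> i \<le> n \<Longrightarrow> fold_tau n t i \<noteq> 0"
  by (auto simp: fold_tau_def)

lemma fold_C_nz:
  "(\<And>i. i \<le> n \<Longrightarrow> t i \<noteq> 0) \<Longrightarrow> (\<And>i. i \<le> n \<Longrightarrow> t' i \<noteq> 0) \<Longrightarrow> (\<And>i. i \<in> {1..n-2} \<Longrightarrow> C i \<noteq> 0)
    \<Longrightarrow> i \<le> n - 1 \<Longrightarrow> fold_C n C t t' i \<noteq> 0"
  by (auto simp: fold_C_def)

definition fold_param :: "nat \<Rightarrow> (nat \<Rightarrow> complex) \<Rightarrow> (nat \<Rightarrow> complex) \<Rightarrow> (nat \<Rightarrow> complex) \<Rightarrow> (nat \<Rightarrow> complex)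
    \<Rightarrow> (nat \<Rightarrow> complex) \<Rightarrow> tuple" where
  "fold_param n m mb t C t' =
    (\<lambda>i\<in>{1..n}. if i = n then 1
       else fold_C n C t t' (i-1) * fold_tau n t' i / (m i * fold_C n C t t' i * fold_tau n t' (i-1)),
     \<lambda>i\<in>{1..n-1}. fold_C n C t t' (i-1) * fold_tau n t i / (mb i * fold_C n C t t' i * fold_tau n t (i-1)))"

text \<open>The extra tau factors of \<open>fold_tau\<close> and \<open>fold_C\<close> cancel: at
  index 1 a square of tau'_0 drops out, at index n - 1 one factor tau'_{n-1}, and likewise for the
  barred entries with tau. The entry of index n is 1 by the equalities in
  \<open>red\<close>.\<close>

lemma param_fold:
  assumes n: "n \<ge> 3" and red: "m n = 1" "t (n-1) = t n" "t' (n-1) = t' n"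
    and t: "\<And>i. i \<le> n \<Longrightarrow> t i \<noteq> 0" and t': "\<And>i. i \<le> n \<Longrightarrow> t' i \<noteq> 0"
  shows "param n (m, mb) t C t' = fold_param n m mb t C t'"
proof (cases "n = 3")
  case True
  have nz: "t 0 \<noteq> 0" "t 1 \<noteq> 0" "t 2 \<noteq> 0" "t' 0 \<noteq> 0" "t' 1 \<noteq> 0" "t' 2 \<noteq> 0"
    using t t' True by auto
  have diff31: "3 - 1 = (2::nat)" by simp
  show ?thesis
    unfolding param_def fold_param_def prod.case if_P[OF True] unfolding True diff31
  proof (intro arg_cong2[where f = Pair] restrict_ext)
    fix i :: nat assume "i \<in> {1..3}"
    then consider "i = 1" | "i = 2" | "i = 3" by force
    then show "inverse (m i) *
          (if i = 1 then t 0 * t' 1 / C 1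
           else if i = 2 then C 1 * t' 2 / (t 2 * t' 0 * t' 1)
           else t 2 * t' 3 / (t 3 * t' 2))
      = (if i = 3 then 1
         else fold_C 3 C t t' (i-1) * fold_tau 3 t' i / (m i * fold_C 3 C t t' i * fold_tau 3 t' (i-1)))"
      using nz red True by cases (simp_all add: fold_tau_def fold_C_def power2_eq_square field_simps)
  next
    fix i :: nat assume "i \<in> {1..2}"
    then consider "i = 1" | "i = 2" by force
    then show "inverse (mb i) *
          (if i = 1 then t 1 * t' 0 / C 1
           else C 1 * t 3 / (t 0 * t 1 * t' 3))
      = fold_C 3 C t t' (i-1) * fold_tau 3 t i / (mb i * fold_C 3 C t t' i * fold_tau 3 t (i-1))"
      using nz red True by cases (simp_all add: fold_tau_def fold_C_def power2_eq_square field_simps)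
  qed
next
  case False
  have nz: "t 0 \<noteq> 0" "t 1 \<noteq> 0" "t' 0 \<noteq> 0" "t' 1 \<noteq> 0" "t n \<noteq> 0" "t' n \<noteq> 0"
    using t t' n by auto
  \<comment> \<open>Writing n as h + 4 makes the indices 1, 2, n - 1 and n visibly distinct.\<close>
  have h: "n = Suc (Suc (Suc (Suc (n - 4))))" using n False by simp
  then obtain h where h: "n = Suc (Suc (Suc (Suc h)))" ..
  show ?thesis
    unfolding param_def fold_param_def prod.case if_not_P[OF False]
  proof (intro arg_cong2[where f = Pair] restrict_ext)
    fix i assume i: "i \<in> {1..n}"
    consider "i = 1" | "i = 2" | "i = n" | "i = n - 1" | g where "i = Suc (Suc (Suc g))" "i \<le> n - 2"
      using i by (cases i; cases "i - 1"; cases "i - 2") force+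
    then show "inverse (m i) *
         (if i = 1 then t 0 * t' 1 / C 1
           else if i = 2 then C 1 * t' 2 / (C 2 * t' 0 * t' 1)
           else if i = n - 1 then C (n-2) * t' (n-1) / (t (n-1) * t' (n-2))
           else if i = n then t (n-1) * t' n / (t n * t' (n-1))
           else C (i-1) * t' i / (C i * t' (i-1)))
      = (if i = n then 1
       else fold_C n C t t' (i-1) * fold_tau n t' i / (m i * fold_C n C t t' i * fold_tau n t' (i-1)))"
      using nz red
      by cases (simp_all add: h fold_tau_def fold_C_def power2_eq_square numeral_2_eq_2 field_simps)
  next
    fix i assume i: "i \<in> {1..n-1}"
    consider "i = 1" | "i = 2" | "i = n - 1" | g where "i = Suc (Suc (Suc g))" "i \<le> n - 2"
      using i by (cases i; cases "i - 1"; cases "i - 2") force+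
    then show "inverse (mb i) *
          (if i = 1 then t 1 * t' 0 / C 1
           else if i = 2 then C 1 * t 2 / (C 2 * t 0 * t 1)
           else if i = n - 1 then C (n-2) * t n / (t (n-2) * t' n)
           else C (i-1) * t i / (C i * t (i-1)))
      = fold_C n C t t' (i-1) * fold_tau n t i / (mb i * fold_C n C t t' i * fold_tau n t (i-1))"
      using nz red
      by cases (simp_all add: h fold_tau_def fold_C_def power2_eq_square numeral_2_eq_2 field_simps)
  qed
qed

text \<open>Step i of the chain is the equation of index i + 1, so the chain encodes <J,1> up to
  <J,n-1>. The equations <J,0> come in through the exchanged data in
  \<open>trop_R_reduced\<close>.\<close>

lemma bilinear_chain_fold:
  assumes n: "n \<ge> 3" and par: "\<alpha> \<noteq> 0" "\<beta> \<noteq> 0"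
    and lk: "(l, lb) \<in> tuples n" "(k, kb) \<in> tuples n"
    and ell: "ell n (l, lb) \<noteq> ell n (k, kb)"
    and SWNE: "\<And>i. i \<in> {1..n-2} \<Longrightarrow> S i \<noteq> 0 \<and> W i \<noteq> 0 \<and> N i \<noteq> 0 \<and> E i \<noteq> 0"
    and tau: "\<And>J i. J \<le> 4 \<Longrightarrow> i \<le> n \<Longrightarrow> \<tau> J i \<noteq> 0"
    and red: "l n = 1" "k n = 1" "\<And>J. J \<le> 4 \<Longrightarrow> \<tau> J (n-1) = \<tau> J n"
    and bil: "\<And>J i. J \<in> {1..4} \<Longrightarrow> i \<le> n \<Longrightarrow> bilinear n \<alpha> \<beta> (l, lb) (k, kb) S W N E \<tau> J i"
  shows "bilinear_chain (n-1) \<alpha> \<beta> l lb k kb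
    (fold_C n W (\<tau> 3) (\<tau> 2)) (fold_C n N (\<tau> 2) (\<tau> 1)) (fold_C n S (\<tau> 3) (\<tau> 4)) (fold_C n E (\<tau> 4) (\<tau> 1))
    (\<tau> 0) (fold_tau n (\<tau> 1)) (fold_tau n (\<tau> 2)) (fold_tau n (\<tau> 3)) (fold_tau n (\<tau> 4))"
proof
  have tn: "\<tau> J n = \<tau> J (n-1)" if "J \<le> 4" for J using red(3)[OF that] by simp
  have n2: "Suc 0 \<noteq> n - Suc 0" using n by auto
  \<comment> \<open>The three cases are the equation of index 1, the one of index n - 1, and the
    generic ones in between.\<close>
  have cases3 [consumes 1]: thesis if "i < n - 1" "i = 0 \<Longrightarrow> thesis" "i = n - 2 \<Longrightarrow> i \<noteq> 0 \<Longrightarrow> Suc i = n - 1 \<Longrightarrow> thesis"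
     "i \<noteq> 0 \<Longrightarrow> i \<noteq> n - Suc 0 \<Longrightarrow> Suc i \<noteq> n - Suc 0 \<Longrightarrow> Suc i \<noteq> n \<Longrightarrow> thesis" for i :: nat and thesis
    using that n by force
  show "n - 1 \<ge> 1" "\<alpha> \<noteq> 0" "\<beta> \<noteq> 0" using n par by simp_all
  {
    fix i assume i: "i \<le> n - 1"
    show "fold_C n W (\<tau> 3) (\<tau> 2) i \<noteq> 0 \<and> fold_C n N (\<tau> 2) (\<tau> 1) i \<noteq> 0 \<and>
        fold_C n S (\<tau> 3) (\<tau> 4) i \<noteq> 0 \<and> fold_C n E (\<tau> 4) (\<tau> 1) i \<noteq> 0"
      using i SWNE tau by (intro conjI fold_C_nz) auto
    show "fold_tau n (\<tau> 1) i \<noteq> 0 \<and> fold_tau n (\<tau> 2) i \<noteq> 0 \<and> fold_tau n (\<tau> 3) i \<noteq> 0 \<and> fold_tau n (\<tau> 4) i \<noteq> 0"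
      using i n tau by (intro conjI fold_tau_nz) auto
  }
  {
    fix i assume i: "i < n - 1"
    show "\<tau> 0 (Suc i) \<noteq> 0" using tau i by simp
    show "l (Suc i) \<noteq> 0 \<and> lb (Suc i) \<noteq> 0 \<and> k (Suc i) \<noteq> 0 \<and> kb (Suc i) \<noteq> 0"
      using lk i by (auto simp: tuples_def dest!: PiE_mem[of _ _ _ "Suc i"])
    have b: "bilinear n \<alpha> \<beta> (l, lb) (k, kb) S W N E \<tau> J (Suc i)" if "J \<in> {1..4}" for J
      using bil that i by simp
    note b1 = b[of 1, simplified] and b2 = b[of 2, simplified] and b3 = b[of 3, simplified] and b4 = b[of 4, simplified]
    note bdefs = bilinear_def bilinear1_def bilinear2_def bilinear3_def bilinear4_def
    note simps = fold_C_def fold_tau_def power2_eq_square tn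
    from i show "k (Suc i) * fold_C n E (\<tau> 4) (\<tau> 1) i * fold_C n N (\<tau> 2) (\<tau> 1) (Suc i)
          - l (Suc i) * fold_C n N (\<tau> 2) (\<tau> 1) i * fold_C n E (\<tau> 4) (\<tau> 1) (Suc i)
        = \<alpha> * \<tau> 0 (Suc i) * fold_tau n (\<tau> 1) (Suc i)"
    proof (cases rule: cases3)
      case 1
      have "k 1 * N 1 * \<tau> 4 0 - l 1 * E 1 * \<tau> 2 0 = \<alpha> * \<tau> 0 1 * \<tau> 1 1"
        using n 1 b1 by (simp add: bdefs)
      \<comment> \<open>The factor tau^1_0 completes tau^4_0 and tau^2_0 to the folded E and N at 0,
        and tau^1_1 to the folded tau^1 at 1. In general <J,1> is multiplied by tau^J_0.\<close>
      from arg_cong[OF this, of "\<lambda>z. z * \<tau> 1 0"] show ?thesis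
        using n n2 1 by (simp add: simps algebra_simps)
    next
      case 2
      have "k (n-1) * k n * E (n-2) * \<tau> 2 n - l (n-1) * l n * N (n-2) * \<tau> 4 n = \<alpha> * \<tau> 0 (n-1) * \<tau> 1 n"
        using n n2[symmetric] 2 b1 by (simp add: bdefs)
      \<comment> \<open>In the same way <J,n-1> is multiplied by tau^J_{n-1}, which on the right
        produces the square in \<open>fold_tau\<close>.\<close>
      from arg_cong[OF this, of "\<lambda>z. z * \<tau> 1 (n-1)"] show ?thesis
        using n n2 2 red(1,2) by (simp add: simps algebra_simps)
    next
      case 3 then show ?thesis using n b1 by (simp add: simps bdefs)
    qed
    from i show "kb (Suc i) * fold_C n W (\<tau> 3) (\<tau> 2) i * fold_C n N (\<tau> 2) (\<tau> 1) (Suc i)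
          + l (Suc i) * fold_C n N (\<tau> 2) (\<tau> 1) i * fold_C n W (\<tau> 3) (\<tau> 2) (Suc i)
        = \<beta> * \<tau> 0 (Suc i) * fold_tau n (\<tau> 2) (Suc i)"
    proof (cases rule: cases3)
      case 1
      have "kb 1 * N 1 * \<tau> 3 0 + l 1 * W 1 * \<tau> 1 0 = \<beta> * \<tau> 0 1 * \<tau> 2 1"
        using n 1 b2 by (simp add: bdefs)
      from arg_cong[OF this, of "\<lambda>z. z * \<tau> 2 0"] show ?thesis
        using n n2 1 by (simp add: simps algebra_simps)
    next
      case 2
      have "k n * kb (n-1) * W (n-2) * \<tau> 1 (n-1) + l (n-1) * N (n-2) * \<tau> 3 (n-1) = \<beta> * \<tau> 0 (n-1) * \<tau> 2 (n-1)"
        using n n2[symmetric] 2 b2 by (simp add: bdefs)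
      from arg_cong[OF this, of "\<lambda>z. z * \<tau> 2 (n-1)"] show ?thesis
        using n n2 2 red(1,2) by (simp add: simps algebra_simps)
    next
      case 3 then show ?thesis using n b2 by (simp add: simps bdefs)
    qed
    from i show "kb (Suc i) * fold_C n W (\<tau> 3) (\<tau> 2) i * fold_C n S (\<tau> 3) (\<tau> 4) (Suc i)
          - lb (Suc i) * fold_C n S (\<tau> 3) (\<tau> 4) i * fold_C n W (\<tau> 3) (\<tau> 2) (Suc i)
        = \<alpha> * \<tau> 0 (Suc i) * fold_tau n (\<tau> 3) (Suc i)"
    proof (cases rule: cases3)
      case 1
      have "kb 1 * S 1 * \<tau> 2 0 - lb 1 * W 1 * \<tau> 4 0 = \<alpha> * \<tau> 0 1 * \<tau> 3 1"
        using n 1 b3 by (simp add: bdefs)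
      from arg_cong[OF this, of "\<lambda>z. z * \<tau> 3 0"] show ?thesis
        using n n2 1 by (simp add: simps algebra_simps)
    next
      case 2
      have "kb (n-1) * W (n-2) * \<tau> 4 n - lb (n-1) * S (n-2) * \<tau> 2 n = \<alpha> * \<tau> 0 (n-1) * \<tau> 3 n"
        using n n2[symmetric] 2 b3 by (simp add: bdefs)
      from arg_cong[OF this, of "\<lambda>z. z * \<tau> 3 (n-1)"] show ?thesis
        using n n2 2 red(1,2) by (simp add: simps algebra_simps)
    next
      case 3 then show ?thesis using n b3 by (simp add: simps bdefs)
    qed
    from i show "k (Suc i) * fold_C n E (\<tau> 4) (\<tau> 1) i * fold_C n S (\<tau> 3) (\<tau> 4) (Suc i)
          + lb (Suc i) * fold_C n S (\<tau> 3) (\<tau> 4) i * fold_C n E (\<tau> 4) (\<tau> 1) (Suc i)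
        = \<beta> * \<tau> 0 (Suc i) * fold_tau n (\<tau> 4) (Suc i)"
    proof (cases rule: cases3)
      case 1
      have "k 1 * S 1 * \<tau> 1 0 + lb 1 * E 1 * \<tau> 3 0 = \<beta> * \<tau> 0 1 * \<tau> 4 1"
        using n 1 b4 by (simp add: bdefs)
      from arg_cong[OF this, of "\<lambda>z. z * \<tau> 4 0"] show ?thesis
        using n n2 1 by (simp add: simps algebra_simps)
    next
      case 2
      have "k (n-1) * E (n-2) * \<tau> 3 (n-1) + l n * lb (n-1) * S (n-2) * \<tau> 1 (n-1) = \<beta> * \<tau> 0 (n-1) * \<tau> 4 (n-1)"
        using n n2[symmetric] 2 b4 by (simp add: bdefs)
      from arg_cong[OF this, of "\<lambda>z. z * \<tau> 4 (n-1)"] show ?thesis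
        using n n2 2 red(1,2) by (simp add: simps algebra_simps)
    next
      case 3 then show ?thesis using n b4 by (simp add: simps bdefs)
    qed
  }
  {
    \<comment> \<open>At both ends \<open>fold_C\<close> is a product of two tau functions and
      \<open>fold_tau\<close> a square, so each relation equates two copies of one monomial.\<close>
    fix i assume i: "i \<in> {0, n - 1}"
    show "(fold_C n W (\<tau> 3) (\<tau> 2) i)\<^sup>2 = fold_tau n (\<tau> 3) i * fold_tau n (\<tau> 2) i"
      "(fold_C n N (\<tau> 2) (\<tau> 1) i)\<^sup>2 = fold_tau n (\<tau> 2) i * fold_tau n (\<tau> 1) i"
      "fold_C n S (\<tau> 3) (\<tau> 4) i * fold_C n W (\<tau> 3) (\<tau> 2) i * fold_tau n (\<tau> 1) i
        = fold_C n E (\<tau> 4) (\<tau> 1) i * fold_C n N (\<tau> 2) (\<tau> 1) i * fold_tau n (\<tau> 3) i"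
      "fold_C n S (\<tau> 3) (\<tau> 4) i * fold_C n E (\<tau> 4) (\<tau> 1) i * fold_tau n (\<tau> 2) i
        = fold_tau n (\<tau> 4) i * fold_C n N (\<tau> 2) (\<tau> 1) i * fold_C n W (\<tau> 3) (\<tau> 2) i"
      using i n by (auto simp: fold_C_def fold_tau_def power2_eq_square)
  }
  show "(\<Prod>i=1..n-1. l i * lb i) \<noteq> (\<Prod>i=1..n-1. k i * kb i)"
    using ell n ell_reduced[of n l lb] ell_reduced[of n k kb] red by simp
qed

section \<open>The involution \<open>sigma_1\<close> as an exchange of the indices 0 and 1\<close>

text \<open>The exchange turns the formula for z_1 into the one for its barred partner and back; the
  entries of index 2 contain tau_0 and tau_1 only through their product, and later entries do not
  contain them.\<close>

lemma param_swap:
  assumes "n \<ge> 3"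
  shows "param n (l(1 := lb 1), lb(1 := l 1)) (t(0 := t 1, 1 := t 0)) C (t'(0 := t' 1, 1 := t' 0))
    = (let (z, zb) = param n (l, lb) t C t' in (z(1 := zb 1), zb(1 := z 1)))"
proof (intro prod_eqI ext)
  fix i
  consider "i = 0" | "i = 1" | "i = 2" | g where "i = Suc (Suc (Suc g))"
    by (cases i; cases "i - 1"; cases "i - 2") auto
  note i_cases = this
  have "n = Suc (Suc (Suc (n - 3)))" using assms by simp
  then obtain h where h: "n = Suc (Suc (Suc h))" ..
  show "fst (param n (l(1 := lb 1), lb(1 := l 1)) (t(0 := t 1, 1 := t 0)) C (t'(0 := t' 1, 1 := t' 0))) i
    = fst (let (z, zb) = param n (l, lb) t C t' in (z(1 := zb 1), zb(1 := z 1))) i"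
    by (rule i_cases) (simp_all add: h param_def numeral_2_eq_2 numeral_3_eq_3 mult_ac)
  show "snd (param n (l(1 := lb 1), lb(1 := l 1)) (t(0 := t 1, 1 := t 0)) C (t'(0 := t' 1, 1 := t' 0))) i
    = snd (let (z, zb) = param n (l, lb) t C t' in (z(1 := zb 1), zb(1 := z 1))) i"
    by (rule i_cases) (simp_all add: h param_def numeral_2_eq_2 numeral_3_eq_3 mult_ac)
qed

lemma sigma_1_param:
  assumes "n \<ge> 3"
  shows "sigma_1 (param n (l, lb) t C t', param n (k, kb) s D s')
    = (param n (l(1 := lb 1), lb(1 := l 1)) (t(0 := t 1, 1 := t 0)) C (t'(0 := t' 1, 1 := t' 0)),
       param n (k(1 := kb 1), kb(1 := k 1)) (s(0 := s 1, 1 := s 0)) D (s'(0 := s' 1, 1 := s' 0)))"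
  unfolding param_swap[OF assms] by (simp add: sigma_1_def Let_def case_prod_beta)

text \<open><J,0> and <J,1> are mirror images under the exchange, and the equations of index at
  least 2 involve none of the exchanged quantities.\<close>

lemma bilinear_swap:
  assumes "n \<ge> 3"
  shows "bilinear n \<alpha> \<beta> (l(1 := lb 1), lb(1 := l 1)) (k(1 := kb 1), kb(1 := k 1)) S W N E
      (\<lambda>J. (\<tau> J)(0 := \<tau> J 1, 1 := \<tau> J 0)) J i
    = bilinear n \<alpha> \<beta> (l, lb) (k, kb) S W N E \<tau> J (if i = 0 then 1 else if i = 1 then 0 else i)"
  using assms by (auto simp: bilinear_def bilinear1_def bilinear2_def bilinear3_def bilinear4_def)

lemma ell_swap:
  assumes "n \<ge> 3" "l n = 1"
  shows "ell n (l(1 := lb 1), lb(1 := l 1)) = ell n (l, lb)"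
  using assms by (auto simp: ell_reduced intro!: prod.cong)

lemma param_in_tuples:
  assumes "n \<ge> 3" "mu \<in> tuples n" "\<And>i. i \<le> n \<Longrightarrow> t i \<noteq> 0" "\<And>i. i \<le> n \<Longrightarrow> t' i \<noteq> 0"
    "\<And>i. i \<in> {1..n-2} \<Longrightarrow> C i \<noteq> 0"
  shows "param n mu t C t' \<in> tuples n"
proof -
  obtain m mb where mu: "mu = (m, mb)" by force
  have m: "m i \<noteq> 0" if "1 \<le> i" "i \<le> n" for i
    using assms(2) that by (auto simp: mu tuples_def dest: PiE_mem)
  have mb: "mb i \<noteq> 0" if "1 \<le> i" "i \<le> n - 1" for i
    using assms(2) that by (auto simp: mu tuples_def dest: PiE_mem)
  have C: "C (i - Suc 0) \<noteq> 0" if "1 \<le> i" "i \<noteq> Suc 0" "i \<le> n - 1" for i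
  proof -
    have "i - 1 \<in> {1..n-2}" using that assms(1) by auto
    then show ?thesis using assms(5)[of "i-1"] by simp
  qed
  show ?thesis
    using assms(1,3-5) m mb C unfolding mu param_def tuples_def by (auto simp: PiE_iff)
qed

section \<open>The tropical R on the reduced data, from two chains\<close>

text \<open>Chain \<open>A\<close> is built from the given data and chain \<open>B\<close> from the
  data with indices 0 and 1 exchanged. \<open>B\<close> serves to compute V_0^{sigma_1}, the
  hypothesis \<open>sig\<close> of \<open>A.trop_R_eq\<close>.\<close>

theorem trop_R_reduced:
  assumes n: "n \<ge> 3" and par: "\<alpha> \<noteq> 0" "\<beta> \<noteq> 0"
    and lk: "(l, lb) \<in> tuples n" "(k, kb) \<in> tuples n"
    and ell: "ell n (l, lb) \<noteq> ell n (k, kb)"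
    and SWNE: "\<And>i. i \<in> {1..n-2} \<Longrightarrow> S i \<noteq> 0 \<and> W i \<noteq> 0 \<and> N i \<noteq> 0 \<and> E i \<noteq> 0"
    and tau: "\<And>J i. J \<le> 4 \<Longrightarrow> i \<le> n \<Longrightarrow> \<tau> J i \<noteq> 0"
    and red: "l n = 1" "k n = 1" "\<And>J. J \<le> 4 \<Longrightarrow> \<tau> J (n-1) = \<tau> J n"
    and bil: "\<And>J i. J \<in> {1..4} \<Longrightarrow> i \<le> n \<Longrightarrow> bilinear n \<alpha> \<beta> (l, lb) (k, kb) S W N E \<tau> J i"
  shows "trop_R n (param n (l, lb) (\<tau> 3) W (\<tau> 2), param n (k, kb) (\<tau> 2) N (\<tau> 1))
    = Some (param n (k, kb) (\<tau> 3) S (\<tau> 4), param n (l, lb) (\<tau> 4) E (\<tau> 1))"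
proof -
  interpret A: bilinear_chain "n-1" \<alpha> \<beta> l lb k kb
    "fold_C n W (\<tau> 3) (\<tau> 2)" "fold_C n N (\<tau> 2) (\<tau> 1)" "fold_C n S (\<tau> 3) (\<tau> 4)" "fold_C n E (\<tau> 4) (\<tau> 1)"
    "\<tau> 0" "fold_tau n (\<tau> 1)" "fold_tau n (\<tau> 2)" "fold_tau n (\<tau> 3)" "fold_tau n (\<tau> 4)"
    by (rule bilinear_chain_fold[OF assms])
  define sw where "sw t = t(0 := t 1, 1 := t 0)" for t :: "nat \<Rightarrow> complex"
  define l' lb' k' kb' where l': "l' = l(1 := lb 1)" and lb': "lb' = lb(1 := l 1)"
    and k': "k' = k(1 := kb 1)" and kb': "kb' = kb(1 := k 1)"
  define \<tau>' where "\<tau>' J = sw (\<tau> J)" for J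
  have tau': "\<tau>' J i \<noteq> 0" if "J \<le> 4" "i \<le> n" for J i
    using tau that n by (simp add: \<tau>'_def sw_def)
  have red': "l' n = 1" "k' n = 1" "\<And>J. J \<le> 4 \<Longrightarrow> \<tau>' J (n-1) = \<tau>' J n"
    using red n by (auto simp: l' k' \<tau>'_def sw_def)
  interpret B: bilinear_chain "n-1" \<alpha> \<beta> l' lb' k' kb'
    "fold_C n W (\<tau>' 3) (\<tau>' 2)" "fold_C n N (\<tau>' 2) (\<tau>' 1)" "fold_C n S (\<tau>' 3) (\<tau>' 4)" "fold_C n E (\<tau>' 4) (\<tau>' 1)"
    "\<tau>' 0" "fold_tau n (\<tau>' 1)" "fold_tau n (\<tau>' 2)" "fold_tau n (\<tau>' 3)" "fold_tau n (\<tau>' 4)"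
  proof (rule bilinear_chain_fold[OF n par])
    show "(l', lb') \<in> tuples n" "(k', kb') \<in> tuples n"
      using lk n unfolding l' lb' k' kb' tuples_def by (auto simp: PiE_iff extensional_def)
    show "ell n (l', lb') \<noteq> ell n (k', kb')"
      unfolding l' lb' k' kb' using ell ell_swap n red by simp
    show "bilinear n \<alpha> \<beta> (l', lb') (k', kb') S W N E \<tau>' J i" if "J \<in> {1..4}" "i \<le> n" for J i
      unfolding l' lb' k' kb' \<tau>'_def[abs_def] sw_def bilinear_swap[OF n] using bil that n by simp
  qed (use SWNE tau' red' in auto)
  have pf: "param n (l, lb) (\<tau> J) C (\<tau> K) = fold_param n l lb (\<tau> J) C (\<tau> K)"
    "param n (k, kb) (\<tau> J) C (\<tau> K) = fold_param n k kb (\<tau> J) C (\<tau> K)"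
    "param n (l', lb') (\<tau>' J) C (\<tau>' K) = fold_param n l' lb' (\<tau>' J) C (\<tau>' K)"
    "param n (k', kb') (\<tau>' J) C (\<tau>' K) = fold_param n k' kb' (\<tau>' J) C (\<tau>' K)"
    if "J \<in> {1..4}" "K \<in> {1..4}" for J K C
    using that n red red' tau tau' by (simp_all add: param_fold)
  have J: "1 \<in> {1..4::nat}" "2 \<in> {1..4::nat}" "3 \<in> {1..4::nat}" "4 \<in> {1..4::nat}" by simp_all
  have sig: "sigma_1 (param n (l, lb) (\<tau> 3) W (\<tau> 2), param n (k, kb) (\<tau> 2) N (\<tau> 1))
     = (param n (l', lb') (\<tau>' 3) W (\<tau>' 2), param n (k', kb') (\<tau>' 2) N (\<tau>' 1))"
    unfolding sigma_1_param[OF n] l' lb' k' kb' \<tau>'_def sw_def by simp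
  \<comment> \<open>By \<open>prod_x\<close> and \<open>prod_y\<close> only the products
    \<open>l i * lb i\<close> and \<open>k i * kb i\<close> matter, and these are symmetric under
    the exchange.\<close>
  have "B.d = A.d"
    unfolding A.d_def B.d_def A.prod_x A.prod_y B.prod_x B.prod_y
    by (intro arg_cong2[where f = "\<lambda>x y. 1 / x - 1 / y"] prod.cong) (auto simp: l' lb' k' kb')
  then have c: "B.c = A.c" by (simp only: A.c_def B.c_def)
  have "V n (sigma_1 (param n (l, lb) (\<tau> 3) W (\<tau> 2), param n (k, kb) (\<tau> 2) N (\<tau> 1))) 0 = B.v 0"
    unfolding sig unfolding pf[OF J(3) J(2)] pf[OF J(2) J(1)] V.simps fold_param_def
    by (rule B.V0_eq) (use n in \<open>auto simp: B.x_def B.xb_def B.y_def[unfolded One_nat_def] B.yb_def[unfolded One_nat_def]\<close>)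
  \<comment> \<open>Unfolded, \<open>A.v 0\<close> is \<open>A.c\<close> times tau^2_0 tau^4_0 /
    (tau^1_0 tau^3_0), and \<open>B.v 0\<close> is the same expression with index 1. Their product
    is \<open>A.u 1\<close>.\<close>
  also have "\<dots> = A.u 1 / A.v 0"
    using n tau[of 1 0] tau[of 2 0] tau[of 3 0] tau[of 4 0] tau[of 1 1] tau[of 2 1] tau[of 3 1] tau[of 4 1] A.c_nz
    unfolding A.u_def A.v_def B.v_def c
    by (simp add: fold_C_def fold_tau_def \<tau>'_def sw_def power2_eq_square)
  finally have V01: "V n (sigma_1 (param n (l, lb) (\<tau> 3) W (\<tau> 2), param n (k, kb) (\<tau> 2) N (\<tau> 1))) 0 = A.u 1 / A.v 0" .
  have tup: "param n (l, lb) (\<tau> 3) W (\<tau> 2) \<in> tuples n" "param n (k, kb) (\<tau> 2) N (\<tau> 1) \<in> tuples n"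
    using param_in_tuples n lk tau SWNE by simp_all
  show ?thesis
    using V01 tup
    unfolding pf[OF J(3) J(2)] pf[OF J(2) J(1)] pf[OF J(3) J(4)] pf[OF J(4) J(1)] fold_param_def
    by (intro A.trop_R_eq) (use n in \<open>auto simp: A.x_def A.xb_def A.y_def[unfolded One_nat_def] A.yb_def[unfolded One_nat_def]\<close>)
qed

section \<open>Descent to the A and C types\<close>

lemma in_image_rho_A:
  assumes "n \<ge> 1" "z \<in> tuples n" "fst z n = 1"
  shows "z \<in> rho_A (n-1) ` tuples_A (n-1)"
proof
  obtain m where n: "n = Suc m" using assms(1) by (cases n) auto
  show "(restrict (fst z) {1..n-1}, snd z) \<in> tuples_A (n-1)"
    using assms(2) by (auto simp: tuples_def tuples_A_def n PiE_iff)
  show "z = rho_A (n-1) (restrict (fst z) {1..n-1}, snd z)"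
    using assms(2,3)
    by (intro prod_eqI) (auto simp: tuples_def rho_A_def n fun_eq_iff PiE_iff extensional_def)
qed

lemma in_image_rho_C:
  assumes "n \<ge> 2" "z \<in> tuples n" "fst z n = 1" "fst z 1 = snd z 1"
  shows "z \<in> rho_C (n-2) ` tuples_C (n-2)"
proof
  \<comment> \<open>Undoes the index shift of \<open>rho_C\<close>: the entry of index 0 is z_1,
    which by assumption is also the barred entry of index 1.\<close>
  define w where "w = (\<lambda>i\<in>{0..n-2}. fst z (Suc i), \<lambda>i\<in>{1..n-2}. snd z (Suc i))"
  have "n = Suc (Suc (n - 2))" using assms(1) by simp
  then obtain m where n: "n = Suc (Suc m)" ..
  show "w \<in> tuples_C (n-2)"
    using assms(2) by (auto simp: w_def tuples_def tuples_C_def n PiE_iff)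
  show "z = rho_C (n-2) w"
    using assms(2-4)
    by (intro prod_eqI)
      (auto simp: w_def tuples_def rho_C_def n fun_eq_iff PiE_iff extensional_def Suc_diff_Suc)
qed

lemma fst_param_n:
  assumes "n \<ge> 3" "fst \<mu> n = 1" "t (n-1) = t n" "t' (n-1) = t' n"
    and "\<And>i. i \<le> n \<Longrightarrow> t i \<noteq> 0" "\<And>i. i \<le> n \<Longrightarrow> t' i \<noteq> 0"
  shows "fst (param n \<mu> t C t') n = 1"
  using param_fold[of n "fst \<mu>" t t' "snd \<mu>" C] assms by (simp add: fold_param_def)

lemma fst_param_1:
  assumes "n \<ge> 3" "fst \<mu> 1 = snd \<mu> 1" "t 0 = t 1" "t' 0 = t' 1"
  shows "fst (param n \<mu> t C t') 1 = snd (param n \<mu> t C t') 1"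
proof -
  have "Suc 0 \<le> n - Suc 0" using assms(1) by simp
  then show ?thesis using assms by (simp add: param_def case_prod_beta)
qed

text \<open>The identifications make the two equations literally equal. Any \<open>J\<close> is
  allowed, since \<open>bilinear\<close> reads values outside 1, 2, 3 as the fourth family.\<close>

lemma bilinear_last_iff:
  assumes "n \<ge> 3" "l n = 1" "k n = 1" "\<And>J. J \<le> 4 \<Longrightarrow> \<tau> J (n-1) = \<tau> J n"
  shows "bilinear n \<alpha> \<beta> (l, lb) (k, kb) S W N E \<tau> J (n-1)
    \<longleftrightarrow> bilinear n \<alpha> \<beta> (l, lb) (k, kb) S W N E \<tau> J n"
proof -
  have ne: "n - Suc 0 \<noteq> Suc 0" "n \<noteq> n - Suc 0" using assms(1) by auto
  show ?thesis
    using assms(1-3) assms(4)[of 0] assms(4)[of 1] assms(4)[of 2] assms(4)[of 3] assms(4)[of 4] ne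
    by (simp add: bilinear_def bilinear1_def bilinear2_def bilinear3_def bilinear4_def)
qed

lemma bilinear_first_iff:
  assumes "l 1 = lb 1" "k 1 = kb 1" "\<And>J. J \<le> 4 \<Longrightarrow> \<tau> J 0 = \<tau> J 1"
  shows "bilinear n \<alpha> \<beta> (l, lb) (k, kb) S W N E \<tau> J 0
    \<longleftrightarrow> bilinear n \<alpha> \<beta> (l, lb) (k, kb) S W N E \<tau> J 1"
  using assms(1-2) assms(3)[of 0] assms(3)[of 1] assms(3)[of 2] assms(3)[of 3] assms(3)[of 4]
  by (simp add: bilinear_def bilinear1_def bilinear2_def bilinear3_def bilinear4_def)

theorem mainTheorem3:
  fixes n :: nat and \<alpha> \<beta> :: complex
    and lam kap x y x' y' :: tuple
    and S W N E :: "nat \<Rightarrow> complex"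
    and \<tau> :: "nat \<Rightarrow> nat \<Rightarrow> complex"
  assumes n: "n \<ge> 3"
    and par: "\<alpha> \<noteq> 0" "\<beta> \<noteq> 0"
    and lamkap: "lam \<in> tuples n" "kap \<in> tuples n"
    and ell: "ell n lam * ell n kap * (ell n lam - ell n kap) \<noteq> 0"
    and SWNE: "\<forall>i\<in>{1..n-2}. S i \<noteq> 0 \<and> W i \<noteq> 0 \<and> N i \<noteq> 0 \<and> E i \<noteq> 0"
    and tau: "\<forall>J\<in>{0..4}. \<forall>i\<in>{0..n}. \<tau> J i \<noteq> 0"
    and x: "x = param n lam (\<tau> 3) W (\<tau> 2)"
    and y: "y = param n kap (\<tau> 2) N (\<tau> 1)"
    and x': "x' = param n kap (\<tau> 3) S (\<tau> 4)"
    and y': "y' = param n lam (\<tau> 4) E (\<tau> 1)"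
    and A: "fst lam n = 1" "fst kap n = 1" "\<forall>J\<in>{0..4}. \<tau> J (n-1) = \<tau> J n"
  shows
    "(\<forall>J\<in>{1..4}. bilinear n \<alpha> \<beta> lam kap S W N E \<tau> J (n-1)
                 \<longleftrightarrow> bilinear n \<alpha> \<beta> lam kap S W N E \<tau> J n)
     \<and>
     ((\<forall>J\<in>{1..4}. \<forall>i\<in>{0..n}. bilinear n \<alpha> \<beta> lam kap S W N E \<tau> J i) \<longrightarrow>
        fst x n = 1 \<and> fst y n = 1 \<and> fst x' n = 1 \<and> fst y' n = 1 \<and>
        {x, y, x', y'} \<subseteq> rho_A (n-1) ` tuples_A (n-1) \<and>
        trop_R_A (n-1) (rho_A_inv (n-1) x, rho_A_inv (n-1) y)
          = Some (rho_A_inv (n-1) x', rho_A_inv (n-1) y'))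
     \<and>
     (fst lam 1 = snd lam 1 \<and> fst kap 1 = snd kap 1 \<and> (\<forall>J\<in>{0..4}. \<tau> J 0 = \<tau> J 1) \<longrightarrow>
        (\<forall>J\<in>{1..4}. bilinear n \<alpha> \<beta> lam kap S W N E \<tau> J 0
                    \<longleftrightarrow> bilinear n \<alpha> \<beta> lam kap S W N E \<tau> J 1)
        \<and>
        ((\<forall>J\<in>{1..4}. \<forall>i\<in>{0..n}. bilinear n \<alpha> \<beta> lam kap S W N E \<tau> J i) \<longrightarrow>
           fst x 1 = snd x 1 \<and> fst y 1 = snd y 1 \<and> fst x' 1 = snd x' 1 \<and> fst y' 1 = snd y' 1 \<and>
           {x, y, x', y'} \<subseteq> rho_C (n-2) ` tuples_C (n-2) \<and>
           trop_R_C (n-2) (rho_C_inv (n-2) x, rho_C_inv (n-2) y)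
             = Some (rho_C_inv (n-2) x', rho_C_inv (n-2) y')))"
proof (intro conjI impI)
  obtain l lb k kb where lk: "lam = (l, lb)" "kap = (k, kb)" by force
  have red: "l n = 1" "k n = 1" "\<And>J. J \<le> 4 \<Longrightarrow> \<tau> J (n-1) = \<tau> J n"
    using A by (simp_all add: lk)
  have tau': "\<tau> J i \<noteq> 0" if "J \<le> 4" "i \<le> n" for J i
    using tau that by simp
  have tup: "x \<in> tuples n" "y \<in> tuples n" "x' \<in> tuples n" "y' \<in> tuples n"
    unfolding x y x' y' using n lamkap tau' SWNE by (auto intro!: param_in_tuples)
  have last: "fst x n = 1" "fst y n = 1" "fst x' n = 1" "fst y' n = 1"
    unfolding x y x' y' using n A tau' by (auto intro!: fst_param_n)
  then have imA: "{x, y, x', y'} \<subseteq> rho_A (n-1) ` tuples_A (n-1)"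
    unfolding insert_subset using tup n by (intro conjI empty_subsetI in_image_rho_A) auto
  show "\<forall>J\<in>{1..4}. bilinear n \<alpha> \<beta> lam kap S W N E \<tau> J (n-1)
                 \<longleftrightarrow> bilinear n \<alpha> \<beta> lam kap S W N E \<tau> J n"
    unfolding lk using bilinear_last_iff n red by blast
  \<comment> \<open>A single statement about \<open>trop_R\<close> serves both reductions; each is
    then a matter of pulling it back along an embedding.\<close>
  have R: "trop_R n (x, y) = Some (x', y')"
    if "\<forall>J\<in>{1..4}. \<forall>i\<in>{0..n}. bilinear n \<alpha> \<beta> lam kap S W N E \<tau> J i"
    unfolding x y x' y' lk
    using n par lamkap ell SWNE tau' red that
    by (intro trop_R_reduced[of n \<alpha> \<beta>]) (auto simp: lk)
  show "fst x n = 1" "fst y n = 1" "fst x' n = 1" "fst y' n = 1" by fact+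
  show "{x, y, x', y'} \<subseteq> rho_A (n-1) ` tuples_A (n-1)" by fact
  \<comment> \<open>By \<open>imA\<close> all four tuples lie in the image of \<open>rho_A\<close>,
    so applying \<open>rho_A\<close> after its inverse returns them and \<open>trop_R_A_iff\<close>
    reduces the claim to \<open>R\<close>.\<close>
  show "trop_R_A (n-1) (rho_A_inv (n-1) x, rho_A_inv (n-1) y)
          = Some (rho_A_inv (n-1) x', rho_A_inv (n-1) y')"
    if "\<forall>J\<in>{1..4}. \<forall>i\<in>{0..n}. bilinear n \<alpha> \<beta> lam kap S W N E \<tau> J i"
    using R[OF that] imA n by (simp add: trop_R_A_iff inv_into_into f_inv_into_f)
  assume C: "fst lam 1 = snd lam 1 \<and> fst kap 1 = snd kap 1 \<and> (\<forall>J\<in>{0..4}. \<tau> J 0 = \<tau> J 1)"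
  have first: "fst x 1 = snd x 1" "fst y 1 = snd y 1" "fst x' 1 = snd x' 1" "fst y' 1 = snd y' 1"
    unfolding x y x' y' using n C by (simp_all add: fst_param_1[unfolded One_nat_def])
  with last have imC: "{x, y, x', y'} \<subseteq> rho_C (n-2) ` tuples_C (n-2)"
    unfolding insert_subset using tup n by (intro conjI empty_subsetI in_image_rho_C) auto
  show "\<forall>J\<in>{1..4}. bilinear n \<alpha> \<beta> lam kap S W N E \<tau> J 0
                    \<longleftrightarrow> bilinear n \<alpha> \<beta> lam kap S W N E \<tau> J 1"
    unfolding lk using C by (intro ballI bilinear_first_iff) (auto simp: lk)
  show "fst x 1 = snd x 1" "fst y 1 = snd y 1" "fst x' 1 = snd x' 1" "fst y' 1 = snd y' 1" by fact+
  show "{x, y, x', y'} \<subseteq> rho_C (n-2) ` tuples_C (n-2)" by fact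
  show "trop_R_C (n-2) (rho_C_inv (n-2) x, rho_C_inv (n-2) y)
             = Some (rho_C_inv (n-2) x', rho_C_inv (n-2) y')"
    if "\<forall>J\<in>{1..4}. \<forall>i\<in>{0..n}. bilinear n \<alpha> \<beta> lam kap S W N E \<tau> J i"
  proof -
    \<comment> \<open>\<open>trop_R_C_iff\<close> speaks of \<open>trop_R\<close> at (n - 2) + 2;
      with truncated subtraction this equals n because n is at least 2.\<close>
    have "Suc (Suc (n-2)) = n" using n by simp
    then show ?thesis
      using R[OF that] imC by (simp add: trop_R_C_iff inv_into_into f_inv_into_f)
  qed
qed

end
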